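(* Suppose that for every integer $k\ge 0$ there is a set $\mathcal{L}$ of local chains of deficit $k$ and an involution $\mathcal{S}\mapsto\mathcal{S}^*$ on $\mathcal{L}$ such that: (L-a) for every $\mu\in\mathrm{Par}(k)$, $\mathrm{tail}(\mu)$ belongs to $\mathcal{L}$; (L-b) for any two distinct chains in $\mathcal{L}$, either the two chains are disjoint or the right part of one chain equals the left part of the other chain; (L-c) every $\gamma\in\mathrm{Def}(k)$ belongs to exactly one or two local chains in $\mathcal{L}$; in the former case $\gamma$ belongs to the middle part of the chain, and in the latter case $\gamma$ belongs to the right part of one chain and the left part of the other; (L-d) for all $\mathcal{S}\in\mathcal{L}$, the local chains $\mathcal{S}$ and $\mathcal{S}^*$ are locally opposite; (L-e) for all $\mathcal{S},\mathcal{T}\in\mathcal{L}$, if $\mathcal{S}\cap\mathcal{T}\neq\emptyset$ then $\mathcal{S}^*\cap\mathcal{T}^*\neq\emptyset$; (L-f) for all $\mathcal{S}\in\mathcal{L}$, $\mathrm{left}(\mathcal{S})\cup\mathrm{mid}(\mathcal{S})$ is a union of $\nu$-segments (the empty union being allowed). Then there exist collections of partitions $\mathcal{C}_\mu$, indexed by all integer partitions $\mu$, and a size-preserving involution $\mu\mapsto\mu^*$ on $\mathrm{Par}$, such that: (a) the collections $\mathcal{C}_\mu$ are pairwise disjoint; (b) for all $\gamma\in\mathcal{C}_\mu$, $\mathrm{defc}(\gamma)=|\mu|$; (c) each $\mathcal{C}_\mu$ has the form $\{C_\mu(a),C_\mu(a+1),C_\mu(a+2),\ldots\}$, where $a=\ell(\mu^*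 )$ and $\mathrm{dinv}(C_\mu(i))=i$ for all $i\ge a$; (d) for every $k\ge 0$, every $\gamma\in\mathrm{Def}(k)$ belongs to $\mathcal{C}_\mu$ for some $\mu\in\mathrm{Par}(k)$; (e) for all $\mu$, $\mathrm{tail}(\mu)\subseteq\mathcal{C}_\mu$; (f) for all $\gamma\in\mathcal{C}_\mu$, if $\nu(\gamma)$ is defined then $\nu(\gamma)\in\mathcal{C}_\mu$; (g) for all $n\ge 0$ and all $\mu$, $\mathrm{Cat}_{n,\mathcal{C}_\mu}(q,t)=\mathrm{Cat}_{n,\mathcal{C}_{\mu^*}}(t,q)$.
   Context: **Partitions and statistics.** An integer partition $\gamma=(\gamma_1\ge\cdots\ge\gamma_s>0)$ (possibly empty) has length $\ell(\gamma)=s$, size $|\gamma|=\sum\gamma_i$, $\gamma_i=0$ for $i>s$; zero parts may be appended without changing the partition. Its diagram is the set of cells $(i,j)$ with $1\le i\le \ell(\gamma)$, $1\le j\le\gamma_i$; $\gamma'$ is the conjugate. For a cell $c=(i,j)$, $\mathrm{arm}(c)=\gamma_i-j$ and $\mathrm{leg}(c)=\gamma'_j-i$. $\mathrm{dinv}(\gamma)$ is the number of cells $c$ with $\mathrm{arm}(c)-\mathrm{leg}(c)\in\{0,1\}$; $\mathrm{defc}(\gamma)=|\gamma|-\mathrm{dinv}(\gamma)$. $\min_\Delta(\gamma)$ is the least positive integer $n$ such that $\gamma_i\le n-i$ for $1\le i\le\ell(\gamma)$ (i.e. the diagram fits inside that of $(n-1,n-2,\ldots,1)$). $\mathrm{Par}$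 is the set of all partitions, $\mathrm{Par}(k)$ those of size $k$, $\mathrm{Def}(k)$ those with $\mathrm{defc}=k$, and $\mathrm{DP}(n)=\{\gamma:\min_\Delta(\gamma)\le n\}$. For a set $\mathcal{S}$ of partitions, $$\mathrm{Cat}_{n,\mathcal{S}}(q,t)=\sum_{\gamma\in\mathcal{S}\cap\mathrm{DP}(n)}q^{\binom n2-|\gamma|}t^{\mathrm{dinv}(\gamma)}.$$ **The map $\nu$.** $\nu$ is defined on partitions $\gamma$ with $\gamma_1\le\ell(\gamma)+2$ by $\nu(\gamma)=(\ell(\gamma)+1,\gamma_1-1,\ldots,\gamma_{\ell(\gamma)}-1)$. It is injective, raises dinv by 1 and preserves defc. The $\nu$-segment generated by $\gamma$ is the set of all $\nu^m(\gamma)$, over integers $m$ (positive, zero or negative) for which $\nu^m(\gamma)$ is defined. **Tails.** For a nonempty partition $\mu$ with $n_i$ parts equal to $i$, put $N=\mu_1+\ell(\mu)+1$ and let $v=(v_1,\ldots,v_N)=(0,0,1^{n_1},0,1^{n_2},0,\ldots,0,1^{n_{\mu_1}})$ ($1^{r}$ denotes $r$ copies of $1$). Then $\mathrm{TI}(\mu)=(N-1-v_N,\,N-2-v_{N-1},\ldots,1-v_2,\,0-v_1)$; for $\mu$ empty, $N=1$ and $\mathrm{TI}(\mu)$ is the empty partition. It is known that $\nu^m(\mathrm{TI}(\mu))$ is defined for all $m\ge0$, that $\mathrm{defc}(\mathrm{TI}(\mu))=|\mu|$, $\min_\Delta(\mathrm{TI}(\mu))=\mu_1+\ell(\mu)+1$,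 and $\mathrm{dinv}(\mathrm{TI}(\mu))=\binom{\mu_1+\ell(\mu)+1}{2}-\ell(\mu)-|\mu|$. Set $\mathrm{tail}(\mu)=\{\nu^m(\mathrm{TI}(\mu)):m\ge0\}$. **Staircases.** The infinite $(a,m,h)$-staircase is the function $F:\mathbb{Z}_{\ge a}\to\mathbb{Z}$ whose values $F(a),F(a+1),\ldots$ are $m+1$ copies of $h$, then $h$ copies of $h+1$, then $h+1$ copies of $h+2$, then $h+2$ copies of $h+3$, and so on. A finite $(a,m,h)$-staircase is the restriction of $F$ to some $\{a,\ldots,b\}$. **Local chains of deficit $k$** are of the following kinds. *Ordinary:* a sequence $\mathcal{S}=(\gamma(i):a\le i\le a'+m')$ of partitions with $\mathrm{defc}(\gamma(i))=k$ and $\mathrm{dinv}(\gamma(i))=i$, for which there are nonnegative integers $a,a',m,m',h,h'$ with $a+m+1<a'$ such that $F(i)=\min_\Delta(\gamma(i))$ satisfies: $F(a'-1)>F(a')=\cdots=F(a'+m')=h'$, and $F$ restricted to $\{a,\ldots,a'-1\}$ is an $(a,m,h)$-staircase. These integers are uniquely determined, denoted $a_{\mathcal S},a'_{\mathcal S},m_{\mathcal S},m'_{\mathcal S},h_{\mathcal S},h'_{\mathcal S}$. Put $\mathrm{left}(\mathcal S)=\{\gamma(j):a\le j\le a+m\}$, $\mathrm{mid}(\mathcal S)=\{\gamma(j):a+m<j<a'\}$, $\mathrm{right}(\mathcal S)=\{\gamma(j):a'\le j\le a'+m'\}$. *Exceptional:* (1) a singleton $\{\gamma\}$ with $\mathrm{defc}(\gamma)=k$;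 its left and middle parts are empty and its right part is $\{\gamma\}$. (2) $\mathrm{tail}(\mu)$ with $\mu\in\mathrm{Par}(k)$; its left part is $\{\mathrm{TI}(\mu)\}$, its middle part is $\mathrm{tail}(\mu)\setminus\{\mathrm{TI}(\mu)\}$, its right part is empty. **Locally opposite.** Two ordinary local chains $\mathcal S,\mathcal T$ of deficit $k$ are locally opposite iff $m_{\mathcal T}=m'_{\mathcal S}$, $m'_{\mathcal T}=m_{\mathcal S}$, $h_{\mathcal T}=h'_{\mathcal S}$, $h'_{\mathcal T}=h_{\mathcal S}$, $a_{\mathcal S}+m_{\mathcal S}+k+a'_{\mathcal T}=\binom{h_{\mathcal S}}2$ and $a'_{\mathcal S}+m'_{\mathcal S}+k+a_{\mathcal T}=\binom{h'_{\mathcal S}}2$. Two exceptional local chains of deficit $k$ are locally opposite iff one is $\mathrm{tail}(\mu)$ and the other is $\{\gamma\}$ with $\mathrm{dinv}(\gamma)=\ell(\mu)$ and $\min_\Delta(\gamma)=\min_\Delta(\mathrm{TI}(\mu))$. An ordinary and an exceptional chain are never locally opposite. *)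

theory Defs
  imports "HOL-Computational_Algebra.Polynomial"
begin

text \<open>A partition is the weakly decreasing list of its positive parts.\<close>

definition Par :: "nat list set" where
  "Par = {\<gamma>. sorted_wrt (\<ge>) \<gamma> \<and> 0 \<notin> set \<gamma>}"

definition Par_of_size :: "nat \<Rightarrow> nat list set" where
  "Par_of_size k = {\<gamma> \<in> Par. sum_list \<gamma> = k}"

text \<open>Parts are numbered from 1; all parts beyond the length are 0.\<close>

definition part :: "nat list \<Rightarrow> nat \<Rightarrow> nat" where
  "part \<gamma> i = (if 1 \<le> i \<and> i \<le> length \<gamma> then \<gamma> ! (i - 1) else 0)"

definition conj_part :: "nat list \<Rightarrow> nat \<Rightarrow> nat" where
  "conj_part \<gamma> j = card {i \<in> {1..length \<gamma>}. j \<le> part \<gamma> i}"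

definition diagram :: "nat list \<Rightarrow> (nat \<times> nat) set" where
  "diagram \<gamma> = {(i, j). 1 \<le> i \<and> i \<le> length \<gamma> \<and> 1 \<le> j \<and> j \<le> part \<gamma> i}"

definition arm :: "nat list \<Rightarrow> nat \<times> nat \<Rightarrow> int" where
  "arm \<gamma> c = int (part \<gamma> (fst c)) - int (snd c)"

definition leg :: "nat list \<Rightarrow> nat \<times> nat \<Rightarrow> int" where
  "leg \<gamma> c = int (conj_part \<gamma> (snd c)) - int (fst c)"

definition dinv :: "nat list \<Rightarrow> nat" where
  "dinv \<gamma> = card {c \<in> diagram \<gamma>. arm \<gamma> c - leg \<gamma> c \<in> {0, 1}}"

text \<open>The subtraction is exact, since \<^term>\<open>dinv \<gamma>\<close> counts some of the
  \<^term>\<open>sum_list \<gamma>\<close> cells.\<close>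

definition defc :: "nat list \<Rightarrow> nat" where
  "defc \<gamma> = sum_list \<gamma> - dinv \<gamma>"

definition Par_of_defc :: "nat \<Rightarrow> nat list set" where
  "Par_of_defc k = {\<gamma> \<in> Par. defc \<gamma> = k}"

definition min_Delta :: "nat list \<Rightarrow> nat" where
  "min_Delta \<gamma> = (LEAST n. 0 < n \<and> (\<forall>i \<in> {1..length \<gamma>}. part \<gamma> i + i \<le> n))"

definition DP :: "nat \<Rightarrow> nat list set" where
  "DP n = {\<gamma> \<in> Par. min_Delta \<gamma> \<le> n}"

lemma finite_DP: "finite (DP n)"
proof (rule finite_subset)
  show "DP n \<subseteq> {\<gamma>. set \<gamma> \<subseteq> {..n} \<and> length \<gamma> \<le> n}"
  proof
    fix \<gamma> assume "\<gamma> \<in> DP n"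
    then have le: "min_Delta \<gamma> \<le> n" by (simp add: DP_def)
    let ?P = "\<lambda>n. 0 < n \<and> (\<forall>i \<in> {1..length \<gamma>}. part \<gamma> i + i \<le> n)"
    have "?P (Suc (sum_list \<gamma> + length \<gamma>))"
      by (auto simp: part_def intro!: le_SucI add_mono member_le_sum_list)
    then have "?P (min_Delta \<gamma>)"
      unfolding min_Delta_def by (rule LeastI)
    with le have *: "part \<gamma> i + i \<le> n" if "i \<in> {1..length \<gamma>}" for i
      using that by fastforce
    have "\<gamma> ! j \<le> n" if "j < length \<gamma>" for j
      using *[of "Suc j"] that by (simp add: part_def)
    moreover have "length \<gamma> \<le> n"
      using *[of "length \<gamma>"] by (cases "\<gamma> = []") (auto simp: Suc_le_eq)
    ultimately show "\<gamma> \<in> {\<gamma>. set \<gamma> \<subseteq> {..n} \<and> length \<gamma> \<le> n}"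
      by (auto simp: in_set_conv_nth)
  qed
  show "finite {\<gamma>::nat list. set \<gamma> \<subseteq> {..n} \<and> length \<gamma> \<le> n}"
    by (rule finite_lists_length_le) simp
qed

text \<open>The exponent of \<open>q\<close> is exact: a partition in \<^term>\<open>DP n\<close> fits inside
  \<open>(n - 1, n - 2, \<dots>, 1)\<close>, so its size is at most \<^term>\<open>n choose 2\<close>.\<close>

definition Cat :: "nat \<Rightarrow> nat list set \<Rightarrow> 'a::comm_semiring_1 \<Rightarrow> 'a \<Rightarrow> 'a" where
  "Cat n S q t = (\<Sum>\<gamma> \<in> S \<inter> DP n. q ^ ((n choose 2) - sum_list \<gamma>) * t ^ dinv \<gamma>)"

text \<open>The two indeterminates of \<open>\<int>[q][t]\<close>, represented as \<^typ>\<open>int poly poly\<close>.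
  An identity between values of \<^const>\<open>Cat\<close> at these elements is an identity of
  polynomials in \<open>q\<close> and \<open>t\<close>.\<close>

definition var_q :: "int poly poly" where
  "var_q = [:[:0, 1:]:]"

definition var_t :: "int poly poly" where
  "var_t = [:0, 1:]"

definition nu_defined :: "nat list \<Rightarrow> bool" where
  "nu_defined \<gamma> \<longleftrightarrow> part \<gamma> 1 \<le> length \<gamma> + 2"

definition nu :: "nat list \<Rightarrow> nat list" where
  "nu \<gamma> = filter ((<) 0) ((length \<gamma> + 1) # map (\<lambda>x. x - 1) \<gamma>)"

definition nu_step :: "nat list \<Rightarrow> nat list \<Rightarrow> bool" where
  "nu_step \<gamma> \<delta> \<longleftrightarrow> \<gamma> \<in> Par \<and> nu_defined \<gamma> \<and> \<delta> = nu \<gamma>"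

text \<open>The first disjunct is \<open>\<delta> = \<nu>\<^sup>m(\<gamma>)\<close>, the second \<open>\<delta> = \<nu>\<^sup>-\<^sup>m(\<gamma>)\<close>, each including
  that the power is defined.\<close>

definition nu_segment :: "nat list \<Rightarrow> nat list set" where
  "nu_segment \<gamma> = {\<delta>. \<exists>m. (nu_step ^^ m) \<gamma> \<delta> \<or> (nu_step ^^ m) \<delta> \<gamma>}"

text \<open>For nonempty \<open>\<mu>\<close> this is the vector consisting of 0, then for each
  \<open>i = 1, \<dots>, \<mu>\<^sub>1\<close> a 0 followed by as many 1s as \<open>\<mu>\<close> has parts equal to \<open>i\<close>. For the
  empty partition it is the one-entry vector \<open>(0)\<close>.\<close>

definition TI_vec :: "nat list \<Rightarrow> nat list" where
  "TI_vec \<mu> = 0 # concat (map (\<lambda>i. 0 # replicate (count_list \<mu> i) 1) [1..<part \<mu> 1 + 1])"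

text \<open>The \<open>j\<close>-th part is \<open>N - j - v\<close> with \<open>v\<close> the \<open>(N + 1 - j)\<close>-th entry of the vector,
  which has index \<open>N - j\<close> as a list element.\<close>

definition TI :: "nat list \<Rightarrow> nat list" where
  "TI \<mu> = (let N = part \<mu> 1 + length \<mu> + 1 in
     filter ((<) 0) (map (\<lambda>j. N - j - TI_vec \<mu> ! (N - j)) [1..<N + 1]))"

definition tail :: "nat list \<Rightarrow> nat list set" where
  "tail \<mu> = {(nu ^^ m) (TI \<mu>) | m. True}"

text \<open>Value at \<open>i \<ge> a\<close> of the infinite \<open>(a, m, h)\<close>-staircase. The values up to \<open>h + j\<close> take
  up \<open>(m + 1) + h + (h + 1) + \<dots> + (h + j - 1)\<close> arguments, starting from \<open>a\<close>.\<close>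

definition staircase :: "nat \<Rightarrow> nat \<Rightarrow> nat \<Rightarrow> nat \<Rightarrow> nat" where
  "staircase a m h i = h + (LEAST j. i < a + (m + 1) + (\<Sum>r<j. h + r))"

text \<open>A chain is represented by its set of members. For an ordinary chain this loses
  nothing: the member with index \<open>i\<close> is the one with \<^const>\<open>dinv\<close> equal to \<open>i\<close>. The
  parameters are uniquely determined by the set, so the existential quantifiers over them
  in the definitions below all refer to the same values. Ordinary chains are finite with
  at least three members and tails are infinite, so the kinds do not overlap.\<close>

definition ordinary_shape ::
  "nat list set \<Rightarrow> nat \<Rightarrow> nat \<Rightarrow> nat \<Rightarrow> nat \<Rightarrow> nat \<Rightarrow> nat \<Rightarrow> bool" where
  "ordinary_shape S a a' m m' h h' \<longleftrightarrow>
     a + m + 1 < a' \<and>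
     (\<exists>\<gamma>. S = \<gamma> ` {a..a' + m'} \<and>
        (\<forall>i \<in> {a..a' + m'}. \<gamma> i \<in> Par \<and> dinv (\<gamma> i) = i) \<and>
        min_Delta (\<gamma> (a' - 1)) > min_Delta (\<gamma> a') \<and>
        (\<forall>i \<in> {a'..a' + m'}. min_Delta (\<gamma> i) = h') \<and>
        (\<forall>i \<in> {a..a' - 1}. min_Delta (\<gamma> i) = staircase a m h i))"

definition ordinary_chain :: "nat \<Rightarrow> nat list set \<Rightarrow> bool" where
  "ordinary_chain k S \<longleftrightarrow>
     (\<exists>a a' m m' h h'. ordinary_shape S a a' m m' h h') \<and> (\<forall>\<gamma> \<in> S. defc \<gamma> = k)"

definition local_chain :: "nat \<Rightarrow> nat list set \<Rightarrow> bool" where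
  "local_chain k S \<longleftrightarrow>
     ordinary_chain k S \<or>
     (\<exists>\<gamma> \<in> Par_of_defc k. S = {\<gamma>}) \<or>
     (\<exists>\<mu> \<in> Par_of_size k. S = tail \<mu>)"

definition left_part :: "nat list set \<Rightarrow> nat list set" where
  "left_part S = {\<gamma> \<in> S.
     (\<exists>a a' m m' h h'. ordinary_shape S a a' m m' h h' \<and> a \<le> dinv \<gamma> \<and> dinv \<gamma> \<le> a + m) \<or>
     (\<exists>\<mu> \<in> Par. S = tail \<mu> \<and> \<gamma> = TI \<mu>)}"

definition mid_part :: "nat list set \<Rightarrow> nat list set" where
  "mid_part S = {\<gamma> \<in> S.
     (\<exists>a a' m m' h h'. ordinary_shape S a a' m m' h h' \<and> a + m < dinv \<gamma> \<and> dinv \<gamma> < a') \<or>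
     (\<exists>\<mu> \<in> Par. S = tail \<mu> \<and> \<gamma> \<noteq> TI \<mu>)}"

definition right_part :: "nat list set \<Rightarrow> nat list set" where
  "right_part S = {\<gamma> \<in> S.
     (\<exists>a a' m m' h h'. ordinary_shape S a a' m m' h h' \<and> a' \<le> dinv \<gamma> \<and> dinv \<gamma> \<le> a' + m') \<or>
     S = {\<gamma>}}"

definition ordinary_opposite :: "nat \<Rightarrow> nat list set \<Rightarrow> nat list set \<Rightarrow> bool" where
  "ordinary_opposite k S T \<longleftrightarrow>
     ordinary_chain k S \<and> ordinary_chain k T \<and>
     (\<exists>a\<^sub>S a'\<^sub>S m\<^sub>S m'\<^sub>S h\<^sub>S h'\<^sub>S a\<^sub>T a'\<^sub>T m\<^sub>T m'\<^sub>T h\<^sub>T h'\<^sub>T.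
        ordinary_shape S a\<^sub>S a'\<^sub>S m\<^sub>S m'\<^sub>S h\<^sub>S h'\<^sub>S \<and>
        ordinary_shape T a\<^sub>T a'\<^sub>T m\<^sub>T m'\<^sub>T h\<^sub>T h'\<^sub>T \<and>
        m\<^sub>T = m'\<^sub>S \<and> m'\<^sub>T = m\<^sub>S \<and> h\<^sub>T = h'\<^sub>S \<and> h'\<^sub>T = h\<^sub>S \<and>
        a\<^sub>S + m\<^sub>S + k + a'\<^sub>T = h\<^sub>S choose 2 \<and>
        a'\<^sub>S + m'\<^sub>S + k + a\<^sub>T = h'\<^sub>S choose 2)"

definition exceptional_opposite :: "nat \<Rightarrow> nat list set \<Rightarrow> nat list set \<Rightarrow> bool" where
  "exceptional_opposite k S T \<longleftrightarrow>
     (\<exists>\<mu> \<in> Par_of_size k. \<exists>\<gamma> \<in> Par_of_defc k.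
        (S = tail \<mu> \<and> T = {\<gamma>} \<or> S = {\<gamma>} \<and> T = tail \<mu>) \<and>
        dinv \<gamma> = length \<mu> \<and> min_Delta \<gamma> = min_Delta (TI \<mu>))"

definition locally_opposite :: "nat \<Rightarrow> nat list set \<Rightarrow> nat list set \<Rightarrow> bool" where
  "locally_opposite k S T \<longleftrightarrow> ordinary_opposite k S T \<or> exceptional_opposite k S T"

end

theory Submission
  imports Defs "HOL-Library.FuncSet" "HOL-Library.Multiset"
begin

text \<open>
  Fix the deficit \<open>k\<close>, and call the union of the left and middle part of a chain its body.
  The covering condition says that the bodies partition the partitions of deficit \<open>k\<close> and that
  the right part of each chain which is not a tail is the left part of exactly one other chain.
  So the chains form a directed graph in which every chain but a tail has one successor. Along a
  link the least \<open>dinv\<close> of the left part increases, hence walking backwards from any chain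
  stops, and it stops at a singleton. Passing to opposite chains reverses all links
  (\<open>link_opp\<close>); therefore walking forwards stops as well, and it stops at a tail.

  The collection attached to \<open>\<mu>\<close> is the union of the bodies of all chains from which
  \<open>tail(\<mu>)\<close> can be reached. The intervals of values of \<open>dinv\<close> on consecutive bodies
  abut, so the collection has exactly one member for each value from that of the singleton at its
  origin onwards. The opposite of this singleton is some \<open>tail(\<mu>\<^sup>*)\<close>, which defines
  \<open>\<mu>\<^sup>*\<close>, and being opposite to \<open>tail(\<mu>\<^sup>*)\<close> it has
  \<open>dinv = \<ell>(\<mu>\<^sup>*)\<close>. Reversing the path from the origin to \<open>tail(\<mu>)\<close>
  shows \<open>\<mu>\<^sup>*\<^sup>* = \<mu>\<close>.

  For the symmetry of the Catalan polynomials, note that size is \<open>k\<close> plus \<open>dinv\<close>. Thus it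
  suffices to see that whenever \<open>\<gamma>\<close> lies in the collection of \<open>\<mu>\<close> and in
  \<open>DP(n)\<close>, the collection of \<open>\<mu>\<^sup>*\<close> has a member \<open>\<delta>\<close> in \<open>DP(n)\<close> with
  \<open>dinv \<gamma> + k + dinv \<delta> = n choose 2\<close>. The staircase shape makes this a linear
  condition (\<open>opposite_of_left\<close>): in the body of \<open>S\<close>, with left part at height \<open>h\<close>,
  the inequality \<open>min_Delta \<gamma> \<le> n\<close> means \<open>h \<le> n\<close> and
  \<open>dinv \<gamma> + k + b \<le> n choose 2\<close>, where \<open>b\<close> is the least \<open>dinv\<close> on the right
  part of the opposite chain \<open>S\<^sup>*\<close>. So the candidate for \<open>\<delta>\<close> occurs at or after
  the right part of \<open>S\<^sup>*\<close>, which is at height \<open>h\<close> too. That it satisfies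
  \<open>min_Delta \<delta> \<le> n\<close> follows by walking from there to the chain containing it
  (\<open>min_Delta_along_path\<close>), since \<open>min_Delta\<close> drops from the body of a chain to its right part.

  This uses the statistics of all members of a tail. They come from a description of
  \<open>dinv\<close> as a count of pairs of rows (\<open>dinv_eq_card_attack_pairs\<close>), on which the effect of
  \<open>\<nu>\<close> is a bijection (\<open>dinv_nu\<close>), and from an explicit formula for
  \<open>\<nu>\<^sup>s(TI(\<mu>))\<close> (\<open>nu_power_window\<close>).
\<close>

section \<open>Partitions and their parts\<close>

lemma part_nth: "i < length \<gamma> \<Longrightarrow> part \<gamma> (Suc i) = \<gamma> ! i"
  by (simp add: part_def)

lemma part_beyond: "length \<gamma> < i \<Longrightarrow> part \<gamma> i = 0"
  by (simp add: part_def)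

lemma part_pos: "\<gamma> \<in> Par \<Longrightarrow> 1 \<le> i \<Longrightarrow> i \<le> length \<gamma> \<Longrightarrow> 0 < part \<gamma> i"
  by (force simp: part_def Par_def in_set_conv_nth)

lemma part_pos_iff: "\<gamma> \<in> Par \<Longrightarrow> 0 < part \<gamma> i \<longleftrightarrow> 1 \<le> i \<and> i \<le> length \<gamma>"
  using part_pos by (auto simp: part_def split: if_splits)

lemma part_antimono_sorted:
  assumes "sorted_wrt (\<ge>) xs" "1 \<le> i" "i \<le> j"
  shows "part xs j \<le> part xs i"
proof (cases "i < j \<and> j \<le> length xs")
  case True
  then show ?thesis
    using assms sorted_wrt_nth_less[OF assms(1), of "i - 1" "j - 1"] by (auto simp: part_def)
next
  case False
  then show ?thesis using assms by (cases "i = j") (auto simp: part_def)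
qed

lemma part_antimono: "\<gamma> \<in> Par \<Longrightarrow> 1 \<le> i \<Longrightarrow> i \<le> j \<Longrightarrow> part \<gamma> j \<le> part \<gamma> i"
  using part_antimono_sorted by (auto simp: Par_def)

lemma length_eqI:
  assumes "\<gamma> \<in> Par" "\<And>i. 1 \<le> i \<Longrightarrow> 0 < part \<gamma> i \<longleftrightarrow> i \<le> l"
  shows "length \<gamma> = l"
proof (rule antisym)
  show "length \<gamma> \<le> l"
    using assms part_pos_iff[OF assms(1), of "length \<gamma>"] by (cases "length \<gamma>") auto
  show "l \<le> length \<gamma>"
    using assms part_pos_iff[OF assms(1), of l] by (cases l) auto
qed

lemma part_filter_pos:
  "sorted_wrt (\<ge>) xs \<Longrightarrow> part (filter ((<) 0) xs) i = part xs i"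
proof (induction xs arbitrary: i)
  case (Cons x xs)
  show ?case
  proof (cases "x = 0")
    case True
    with Cons.prems have "filter ((<) 0) xs = []" and "\<And>y. y \<in> set xs \<Longrightarrow> y = 0"
      by (auto simp: filter_empty_conv)
    with True show ?thesis by (auto simp: part_def nth_Cons')
  next
    case False
    have "part (y # ys) i = (if i = 1 then y else part ys (i - 1))" for y and ys :: "nat list"
      by (cases i) (auto simp: part_def nth_Cons')
    with False Cons show ?thesis by simp
  qed
qed simp

lemma filter_pos_in_Par: "sorted_wrt (\<ge>) xs \<Longrightarrow> filter ((<) 0) xs \<in> Par"
  by (auto simp: Par_def sorted_wrt_filter)

lemma sum_list_eq_sum_part: "sum_list \<gamma> = (\<Sum>i = 1..length \<gamma>. part \<gamma> i)"
proof -
  have "sum_list \<gamma> = (\<Sum>i = 0..<length \<gamma>. part \<gamma> (Suc i))"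
    by (simp add: sum_list_sum_nth part_nth)
  also have "\<dots> = (\<Sum>i = 1..length \<gamma>. part \<gamma> i)"
    by (subst sum.atLeast_Suc_lessThan_Suc_shift[of "part \<gamma>" 0 "length \<gamma>", unfolded comp_def, symmetric])
       (simp add: atLeastLessThanSuc_atLeastAtMost)
  finally show ?thesis .
qed

lemma diagram_Sigma: "diagram \<gamma> = (SIGMA i:{1..length \<gamma>}. {1..part \<gamma> i})"
  by (auto simp: diagram_def)

lemma dinv_plus_defc: "dinv \<gamma> + defc \<gamma> = sum_list \<gamma>"
proof -
  have "card (diagram \<gamma>) = sum_list \<gamma>"
    by (simp add: diagram_Sigma sum_list_eq_sum_part)
  moreover have "dinv \<gamma> \<le> card (diagram \<gamma>)"
    unfolding dinv_def by (intro card_mono) (auto simp: diagram_Sigma)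
  ultimately show ?thesis by (simp add: defc_def)
qed

lemma le_conj_part_iff:
  assumes "\<gamma> \<in> Par" "1 \<le> j" "1 \<le> r"
  shows "r \<le> conj_part \<gamma> j \<longleftrightarrow> j \<le> part \<gamma> r"
proof
  assume *: "j \<le> part \<gamma> r"
  then have "r \<le> length \<gamma>" using assms part_beyond[of \<gamma> r] by force
  then have "{1..r} \<subseteq> {i \<in> {1..length \<gamma>}. j \<le> part \<gamma> i}"
    using * part_antimono[OF assms(1)] by (auto intro: order_trans)
  from card_mono[OF _ this] show "r \<le> conj_part \<gamma> j" by (simp add: conj_part_def)
next
  assume *: "r \<le> conj_part \<gamma> j"
  show "j \<le> part \<gamma> r"
  proof (rule ccontr)
    assume "\<not> j \<le> part \<gamma> r"
    then have "{i \<in> {1..length \<gamma>}. j \<le> part \<gamma> i} \<subseteq> {1..<r}"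
      using part_antimono[OF assms(1) assms(3)] by (force simp: not_le)
    from card_mono[OF _ this] * assms show False by (simp add: conj_part_def)
  qed
qed

section \<open>The statistic dinv as a number of pairs of rows\<close>

text \<open>For \<open>n\<close> large, \<open>n - offset \<gamma> i\<close> is the entry in position \<open>n + 1 - i\<close> of the
  area vector of the Dyck path that cuts \<open>\<gamma>\<close> out of a staircase with rows
  \<open>n - 1, \<dots>, 1, 0\<close>. The rows continue below the diagram with parts equal to 0.\<close>

definition offset :: "nat list \<Rightarrow> nat \<Rightarrow> nat" where
  "offset \<gamma> i = part \<gamma> i + i"

definition attack_pairs :: "nat list \<Rightarrow> (nat \<times> nat) set" where
  "attack_pairs \<gamma> = {(i, j). 1 \<le> i \<and> i < j \<and> offset \<gamma> i \<in> {offset \<gamma> j, offset \<gamma> j + 1}}"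

text \<open>The contribution of \<open>r\<close> to the first cardinality is
  \<open>[x \<le> f r] - [x \<le> f (Suc r)] + [f (Suc r) = x]\<close>, because \<open>f\<close> climbs by at most one.
  The first two terms telescope, and the last ones count the visits to \<open>x\<close>.\<close>

lemma card_crossings:
  fixes f :: "nat \<Rightarrow> nat"
  assumes "i \<le> M" and "\<And>r. i \<le> r \<Longrightarrow> f (Suc r) \<le> Suc (f r)"
  shows "card {r \<in> {i..<M}. f (Suc r) \<le> x \<and> x \<le> f r} + of_bool (x \<le> f M)
       = of_bool (x \<le> f i) + card {j \<in> {i<..M}. f j = x}"
  using assms(1)
proof (induction M rule: dec_induct)
  case (step M)
  have 1: "{r \<in> {i..<Suc M}. f (Suc r) \<le> x \<and> x \<le> f r}
      = {r \<in> {i..<M}. f (Suc r) \<le> x \<and> x \<le> f r} \<union> (if f (Suc M) \<le> x \<and> x \<le> f M then {M} else {})"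
    using step.hyps by (auto simp: less_Suc_eq)
  have 2: "{j \<in> {i<..Suc M}. f j = x}
      = {j \<in> {i<..M}. f j = x} \<union> (if f (Suc M) = x then {Suc M} else {})"
    using step.hyps by (auto simp: le_Suc_eq)
  show ?case
    using step.IH assms(2)[OF step.hyps(1)]
    by (subst 1, subst 2, subst card_Un_disjoint, simp, simp, simp, subst card_Un_disjoint)
       (auto split: if_splits)
qed simp

lemma offset_Suc_le: "\<gamma> \<in> Par \<Longrightarrow> 1 \<le> r \<Longrightarrow> offset \<gamma> (Suc r) \<le> Suc (offset \<gamma> r)"
  using part_antimono[of \<gamma> r "Suc r"] by (simp add: offset_def)

lemma offset_beyond: "length \<gamma> < j \<Longrightarrow> offset \<gamma> j = j"
  by (simp add: offset_def part_beyond)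

lemma offset_le: "\<gamma> \<in> Par \<Longrightarrow> 1 \<le> i \<Longrightarrow> i \<le> length \<gamma> \<Longrightarrow> offset \<gamma> i \<le> length \<gamma> + part \<gamma> 1"
  using part_antimono[of \<gamma> 1 i] by (simp add: offset_def)

text \<open>Let \<open>r\<close> be the last row that reaches column \<open>j\<close>. The difference of arm and leg of
  \<open>(i, j)\<close> is \<open>d\<close> exactly if \<open>j = offset \<gamma> i - d - r\<close>. Hence the cells in question
  correspond to the rows \<open>r \<ge> i\<close> between which and the next row the offsets cross the level
  \<open>offset \<gamma> i - d\<close> weakly downwards. The offsets climb by at most one per row and end up above
  that level, so these crossings are as many as the later visits to the level.\<close>

lemma card_row_cells:
  assumes "\<gamma> \<in> Par" "1 \<le> i" "i \<le> length \<gamma>" "length \<gamma> + part \<gamma> 1 < M" "d \<le> 1"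
  shows "card {j \<in> {1..part \<gamma> i}. arm \<gamma> (i, j) - leg \<gamma> (i, j) = int d}
       = card {j \<in> {i<..M}. offset \<gamma> j + d = offset \<gamma> i}"
proof -
  let ?u = "offset \<gamma>"
  let ?J = "{j \<in> {1..part \<gamma> i}. arm \<gamma> (i, j) - leg \<gamma> (i, j) = int d}"
  let ?R = "{r \<in> {i..<M}. ?u (Suc r) \<le> ?u i - d \<and> ?u i - d \<le> ?u r}"
  have pos: "0 < part \<gamma> i" using assms part_pos by auto
  have cp: "j \<in> {1..part \<gamma> i} \<Longrightarrow> i \<le> conj_part \<gamma> j \<and> conj_part \<gamma> j < M
      \<and> part \<gamma> (Suc (conj_part \<gamma> j)) < j \<and> j \<le> part \<gamma> (conj_part \<gamma> j)" for j
    using le_conj_part_iff[OF assms(1), of j i] le_conj_part_iff[OF assms(1), of j "conj_part \<gamma> j"]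
      le_conj_part_iff[OF assms(1), of j "Suc (conj_part \<gamma> j)"]
      le_conj_part_iff[OF assms(1), of j M] part_beyond[of \<gamma> M] assms by force
  have "bij_betw (conj_part \<gamma>) ?J ?R"
  proof (rule bij_betwI[where g = "\<lambda>r. ?u i - d - r"])
    show "conj_part \<gamma> \<in> ?J \<rightarrow> ?R"
    proof
      fix j assume j: "j \<in> ?J"
      with cp[of j] show "conj_part \<gamma> j \<in> ?R"
        by (auto simp: offset_def arm_def leg_def)
    qed
    have key: "?u i - d - r \<in> {1..part \<gamma> i} \<and> conj_part \<gamma> (?u i - d - r) = r \<and> r + d < ?u i"
      if "r \<in> ?R" for r
    proof -
      let ?j = "?u i - d - r"
      have r: "i \<le> r" "part \<gamma> (Suc r) + Suc r \<le> ?u i - d" "?u i - d \<le> part \<gamma> r + r"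
        using that by (auto simp: offset_def)
      then have j: "part \<gamma> (Suc r) < ?j" "?j \<le> part \<gamma> r" by auto
      have "?j \<in> {1..part \<gamma> i}" using j part_antimono[OF assms(1), of i r] r assms by auto
      moreover have "r \<le> conj_part \<gamma> ?j" "\<not> Suc r \<le> conj_part \<gamma> ?j"
        using j assms r le_conj_part_iff[OF assms(1), of ?j r]
          le_conj_part_iff[OF assms(1), of ?j "Suc r"] by auto
      ultimately show ?thesis by auto
    qed
    show "(\<lambda>r. ?u i - d - r) \<in> ?R \<rightarrow> ?J"
    proof
      fix r assume "r \<in> ?R"
      from key[OF this] show "?u i - d - r \<in> ?J"
        by (auto simp: arm_def leg_def offset_def)
    qed
    show "?u i - d - conj_part \<gamma> j = j" if "j \<in> ?J" for j
      using that cp[of j] by (auto simp: arm_def leg_def offset_def)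
    show "conj_part \<gamma> (?u i - d - r) = r" if "r \<in> ?R" for r
      using key[OF that] by auto
  qed
  then have "card ?J = card ?R" by (rule bij_betw_same_card)
  also have "\<dots> = card {j \<in> {i<..M}. ?u j = ?u i - d}"
  proof -
    have "?u i - d \<le> ?u M"
      using offset_beyond[of \<gamma> M] offset_le[OF assms(1-3)] assms by simp
    moreover have "i \<le> M" using assms by simp
    ultimately show ?thesis
      using card_crossings[of i M ?u "?u i - d"] offset_Suc_le[OF assms(1)] assms(2) by simp
  qed
  also have "{j \<in> {i<..M}. ?u j = ?u i - d} = {j \<in> {i<..M}. ?u j + d = ?u i}"
    using assms(2,5) by (auto simp: offset_def)
  finally show ?thesis .
qed

lemma attack_pairs_Sigma:
  assumes "\<gamma> \<in> Par" "length \<gamma> + part \<gamma> 1 < M"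
  shows "attack_pairs \<gamma> = (SIGMA i:{1..length \<gamma>}.
    {j \<in> {i<..M}. offset \<gamma> j + 0 = offset \<gamma> i} \<union> {j \<in> {i<..M}. offset \<gamma> j + 1 = offset \<gamma> i})"
proof -
  have "i \<le> length \<gamma> \<and> j \<le> M" if "(i, j) \<in> attack_pairs \<gamma>" for i j
  proof -
    have *: "1 \<le> i" "i < j" "offset \<gamma> j \<le> offset \<gamma> i"
      using that by (auto simp: attack_pairs_def)
    then have i: "i \<le> length \<gamma>"
      using offset_beyond[of \<gamma> i] offset_beyond[of \<gamma> j] by force
    moreover have "j \<le> offset \<gamma> j" by (simp add: offset_def)
    ultimately show ?thesis using * offset_le[OF assms(1), of i] assms(2) by simp
  qed
  then have "p \<in> attack_pairs \<gamma> \<longleftrightarrow> fst p \<in> {1..length \<gamma>} \<and> snd p \<in> {fst p<..M}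
      \<and> (offset \<gamma> (snd p) + 0 = offset \<gamma> (fst p) \<or> offset \<gamma> (snd p) + 1 = offset \<gamma> (fst p))" for p
    by (cases p) (auto simp: attack_pairs_def)
  then show ?thesis by (auto simp: mem_Sigma_iff)
qed

lemma finite_attack_pairs: "\<gamma> \<in> Par \<Longrightarrow> finite (attack_pairs \<gamma>)"
  by (subst attack_pairs_Sigma[OF _ lessI]) auto

text \<open>This is the usual formula for \<open>dinv\<close> of an area vector.\<close>

lemma dinv_eq_card_attack_pairs:
  assumes "\<gamma> \<in> Par"
  shows "dinv \<gamma> = card (attack_pairs \<gamma>)"
proof -
  define M where "M = Suc (length \<gamma> + part \<gamma> 1)"
  let ?J = "\<lambda>d i. {j \<in> {1..part \<gamma> i}. arm \<gamma> (i, j) - leg \<gamma> (i, j) = int d}"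
  let ?P = "\<lambda>d i. {j \<in> {i<..M}. offset \<gamma> j + d = offset \<gamma> i}"
  have "{c \<in> diagram \<gamma>. arm \<gamma> c - leg \<gamma> c \<in> {0, 1}} = (SIGMA i:{1..length \<gamma>}. ?J 0 i \<union> ?J 1 i)"
    by (auto simp: diagram_def)
  then have "dinv \<gamma> = (\<Sum>i = 1..length \<gamma>. card (?J 0 i \<union> ?J 1 i))"
    unfolding dinv_def by (simp only:) (subst card_SigmaI, auto)
  also have "\<dots> = (\<Sum>i = 1..length \<gamma>. card (?J 0 i) + card (?J 1 i))"
    by (intro sum.cong refl card_Un_disjoint) auto
  also have "\<dots> = (\<Sum>i = 1..length \<gamma>. card (?P 0 i) + card (?P 1 i))"
    using assms by (intro sum.cong refl arg_cong2[where f = "(+)"] card_row_cells) (auto simp: M_def)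
  also have "\<dots> = (\<Sum>i = 1..length \<gamma>. card (?P 0 i \<union> ?P 1 i))"
    by (intro sum.cong refl card_Un_disjoint[symmetric]) auto
  also have "\<dots> = card (attack_pairs \<gamma>)"
    by (subst attack_pairs_Sigma[OF assms, of M]) (simp_all add: M_def)
  finally show ?thesis .
qed

section \<open>The map nu\<close>

lemma sorted_nu_list:
  assumes "\<gamma> \<in> Par" "nu_defined \<gamma>"
  shows "sorted_wrt (\<ge>) ((length \<gamma> + 1) # map (\<lambda>x. x - 1) \<gamma>)"
proof -
  have "x \<le> length \<gamma> + 2" if x: "x \<in> set \<gamma>" for x
  proof -
    obtain i where "i < length \<gamma>" "x = \<gamma> ! i" using x by (auto simp: in_set_conv_nth)
    then have "x = part \<gamma> (Suc i)" by (simp add: part_nth)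
    then show ?thesis
      using part_antimono[OF assms(1), of 1 "Suc i"] assms(2) by (simp add: nu_defined_def)
  qed
  moreover have "sorted_wrt (\<lambda>x y. y - 1 \<le> x - Suc 0) \<gamma>"
    using assms(1) by (auto simp: Par_def elim!: sorted_wrt_mono_rel[rotated])
  ultimately show ?thesis by (force simp: sorted_wrt_map)
qed

lemma nu_in_Par: "\<gamma> \<in> Par \<Longrightarrow> nu_defined \<gamma> \<Longrightarrow> nu \<gamma> \<in> Par"
  unfolding nu_def by (intro filter_pos_in_Par sorted_nu_list)

lemma part_nu:
  assumes "\<gamma> \<in> Par" "nu_defined \<gamma>"
  shows "part (nu \<gamma>) (Suc 0) = Suc (length \<gamma>)"
    and "1 \<le> i \<Longrightarrow> part (nu \<gamma>) (Suc i) = part \<gamma> i - 1"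
  unfolding nu_def part_filter_pos[OF sorted_nu_list[OF assms]]
  by (auto simp: part_def nth_Cons')

lemma sum_list_nu:
  assumes "\<gamma> \<in> Par"
  shows "sum_list (nu \<gamma>) = Suc (sum_list \<gamma>)"
proof -
  have "sum_list (filter ((<) 0) xs) = sum_list xs" for xs :: "nat list"
    by (induction xs) auto
  moreover have "0 \<notin> set xs \<Longrightarrow> length xs + sum_list (map (\<lambda>x. x - 1) xs) = sum_list xs" for xs :: "nat list"
    by (induction xs) auto
  from this[of \<gamma>] have "length \<gamma> + sum_list (map (\<lambda>x. x - 1) \<gamma>) = sum_list \<gamma>"
    using assms by (simp add: Par_def)
  ultimately show ?thesis by (simp add: nu_def del: filter.simps)
qed

lemma offset_nu:
  assumes "\<gamma> \<in> Par" "nu_defined \<gamma>"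
  shows "offset (nu \<gamma>) (Suc 0) = length \<gamma> + 2"
    and "1 \<le> i \<Longrightarrow> offset (nu \<gamma>) (Suc i) = (if i \<le> length \<gamma> then offset \<gamma> i else Suc i)"
  using part_pos[OF assms(1), of i] by (auto simp: offset_def part_nu[OF assms] part_beyond)

text \<open>The map \<open>\<nu>\<close> inserts a top row of offset \<open>\<ell> + 2\<close> and moves the nonempty rows down
  without changing their offsets. Attacking pairs of nonempty rows survive, and so do the pairs
  with an empty row below row \<open>\<ell> + 1\<close>. A row \<open>i\<close> attacked row \<open>\<ell> + 1\<close> if its offset was
  \<open>\<ell> + 1\<close> or \<open>\<ell> + 2\<close>, which is the condition for the new top row to attack it. The only
  additional pair consists of the new top row and the empty row \<open>\<ell> + 2\<close>.\<close>

lemma dinv_nu: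
  assumes "\<gamma> \<in> Par" "nu_defined \<gamma>"
  shows "dinv (nu \<gamma>) = Suc (dinv \<gamma>)"
proof -
  let ?l = "length \<gamma>"
  \<comment> \<open>A pair with the first empty row becomes a pair with the new top row.\<close>
  define \<phi> where "\<phi> = (\<lambda>(i, j). if j \<le> ?l then (Suc i, Suc j)
     else if j = Suc ?l then (1, Suc i) else (Suc i, j))"
  have bound: "i \<le> ?l" if "(i, j) \<in> attack_pairs \<gamma>" for i j
    using that attack_pairs_Sigma[OF assms(1) lessI] by auto
  have inj: "inj_on \<phi> (attack_pairs \<gamma>)"
    by (rule inj_onI) (auto simp: \<phi>_def attack_pairs_def split: if_splits)
  have notin: "(1, ?l + 2) \<notin> \<phi> ` attack_pairs \<gamma>"
    using bound by (force simp: \<phi>_def attack_pairs_def split: if_splits)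
  have into: "\<phi> (i, j) \<in> attack_pairs (nu \<gamma>)" if "(i, j) \<in> attack_pairs \<gamma>" for i j
  proof -
    have *: "1 \<le> i" "i < j" "offset \<gamma> i = offset \<gamma> j \<or> offset \<gamma> i = offset \<gamma> j + 1" "i \<le> ?l"
      using that bound by (auto simp: attack_pairs_def)
    consider "j \<le> ?l" | "j = Suc ?l" | "Suc ?l < j" by linarith
    then show ?thesis
    proof cases
      case 3
      then obtain j' where "j = Suc j'" "1 \<le> j'" "?l < j'" by (cases j) auto
      with * 3 show ?thesis
        using offset_nu(2)[OF assms, of i] offset_nu(2)[OF assms, of j'] offset_beyond[of \<gamma> j]
        by (auto simp: \<phi>_def attack_pairs_def)
    qed (use * offset_nu(1)[OF assms] offset_nu(2)[OF assms, of i] offset_nu(2)[OF assms, of j]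
           offset_beyond[of \<gamma> j] in \<open>auto simp: \<phi>_def attack_pairs_def\<close>)
  qed
  have onto: "p \<in> insert (1, ?l + 2) (\<phi> ` attack_pairs \<gamma>)" if p: "p \<in> attack_pairs (nu \<gamma>)" for p
  proof -
    obtain i j where [simp]: "p = (Suc i, Suc j)" and ij: "i < j"
      using p by (cases p; cases "fst p"; cases "snd p") (auto simp: attack_pairs_def)
    have j: "offset (nu \<gamma>) (Suc j) = (if j \<le> ?l then offset \<gamma> j else Suc j)"
      using ij offset_nu(2)[OF assms, of j] by simp
    show ?thesis
    proof (cases "i = 0")
      case True
      show ?thesis
      proof (cases "j \<le> ?l")
        case jl: True
        with True p ij j have "(j, Suc ?l) \<in> attack_pairs \<gamma>" "\<phi> (j, Suc ?l) = p"
          using offset_nu(1)[OF assms] offset_beyond[of \<gamma> "Suc ?l"]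
          by (auto simp: attack_pairs_def \<phi>_def)
        then show ?thesis by (metis image_eqI insertCI)
      next
        case False
        with True p ij j show ?thesis
          using offset_nu(1)[OF assms] by (auto simp: attack_pairs_def)
      qed
    next
      case False
      then have i: "offset (nu \<gamma>) (Suc i) = (if i \<le> ?l then offset \<gamma> i else Suc i)"
        using offset_nu(2)[OF assms, of i] by simp
      with p ij j have il: "i \<le> ?l" by (auto simp: attack_pairs_def split: if_splits)
      show ?thesis
      proof (cases "j \<le> ?l")
        case True
        with False p ij i j il have "(i, j) \<in> attack_pairs \<gamma>" "\<phi> (i, j) = p"
          by (auto simp: attack_pairs_def \<phi>_def)
        then show ?thesis by (metis image_eqI insertCI)
      next
        case jl: False
        with False p ij i j il have "(i, Suc j) \<in> attack_pairs \<gamma>" "\<phi> (i, Suc j) = p"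
          using offset_beyond[of \<gamma> "Suc j"] by (auto simp: attack_pairs_def \<phi>_def)
        then show ?thesis by (metis image_eqI insertCI)
      qed
    qed
  qed
  have "(1, ?l + 2) \<in> attack_pairs (nu \<gamma>)"
    using offset_nu(1)[OF assms] offset_nu(2)[OF assms, of "Suc ?l"] by (simp add: attack_pairs_def)
  with into onto have "attack_pairs (nu \<gamma>) = insert (1, ?l + 2) (\<phi> ` attack_pairs \<gamma>)"
    by (auto simp del: One_nat_def)
  with notin inj show ?thesis
    using finite_attack_pairs[OF assms(1)]
    by (simp add: dinv_eq_card_attack_pairs assms nu_in_Par card_image)
qed

lemma defc_nu: "\<gamma> \<in> Par \<Longrightarrow> nu_defined \<gamma> \<Longrightarrow> defc (nu \<gamma>) = defc \<gamma>"
  using dinv_plus_defc[of \<gamma>] dinv_plus_defc[of "nu \<gamma>"] by (simp add: dinv_nu sum_list_nu)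

lemma min_Delta_le_iff:
  assumes "\<gamma> \<in> Par"
  shows "min_Delta \<gamma> \<le> n \<longleftrightarrow> 0 < n \<and> (\<forall>i \<in> {1..length \<gamma>}. offset \<gamma> i \<le> n)"
proof -
  let ?P = "\<lambda>n. 0 < n \<and> (\<forall>i \<in> {1..length \<gamma>}. part \<gamma> i + i \<le> n)"
  have "?P (Suc (length \<gamma> + part \<gamma> 1))"
    using offset_le[OF assms] by (force simp: offset_def)
  then have "?P (min_Delta \<gamma>)" unfolding min_Delta_def by (rule LeastI)
  moreover have "?P n \<Longrightarrow> min_Delta \<gamma> \<le> n" unfolding min_Delta_def by (rule Least_le)
  ultimately show ?thesis by (force simp: offset_def)
qed

text \<open>The new top row has offset \<open>\<ell> + 2\<close>. Parts equal to 1 disappear, but their offsets are at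
  most \<open>\<ell> + 1\<close> and thus do not affect the maximum.\<close>

lemma min_Delta_nu_le_iff:
  assumes "\<gamma> \<in> Par" "nu_defined \<gamma>"
  shows "min_Delta (nu \<gamma>) \<le> n \<longleftrightarrow> length \<gamma> + 2 \<le> n \<and> min_Delta \<gamma> \<le> n"
proof -
  have par: "nu \<gamma> \<in> Par" using assms by (rule nu_in_Par)
  note iff = part_pos_iff[OF assms(1)] part_pos_iff[OF par]
  show ?thesis
    unfolding min_Delta_le_iff[OF assms(1)] min_Delta_le_iff[OF par]
  proof (intro iffI conjI ballI; elim conjE)
    assume n: "\<forall>i \<in> {1..length (nu \<gamma>)}. offset (nu \<gamma>) i \<le> n"
    have "0 < part (nu \<gamma>) 1" using part_nu(1)[OF assms] by simp
    with n iff(2)[of 1] offset_nu(1)[OF assms] show l: "length \<gamma> + 2 \<le> n" by force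
    show "0 < n" using l by simp
    fix i assume i: "i \<in> {1..length \<gamma>}"
    show "offset \<gamma> i \<le> n"
    proof (cases "1 < part \<gamma> i")
      case True
      with i have "0 < part (nu \<gamma>) (Suc i)" using part_nu(2)[OF assms, of i] by simp
      with n iff(2)[of "Suc i"] i offset_nu(2)[OF assms, of i] show ?thesis by force
    next
      case False
      with i l show ?thesis by (simp add: offset_def)
    qed
  next
    assume l: "length \<gamma> + 2 \<le> n" and n: "\<forall>i \<in> {1..length \<gamma>}. offset \<gamma> i \<le> n"
    show "0 < n" using l by simp
    fix i assume "i \<in> {1..length (nu \<gamma>)}"
    then have i: "0 < part (nu \<gamma>) i" "1 \<le> i" using iff(2) by auto
    show "offset (nu \<gamma>) i \<le> n"
    proof (cases "i = 1")
      case True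
      with l show ?thesis using offset_nu(1)[OF assms] by simp
    next
      case False
      then obtain j where [simp]: "i = Suc j" and j: "1 \<le> j" using i by (cases i) auto
      with i part_nu(2)[OF assms, of j] have "j \<le> length \<gamma>" using iff(1)[of j] by simp
      with n j show ?thesis using offset_nu(2)[OF assms, of j] by simp
    qed
  qed
qed

section \<open>Iterating nu on partitions given by binary words\<close>

text \<open>The entries \<open>v 0, \<dots>, v (N - 1)\<close> are a binary word starting with \<open>00\<close>, or the word \<open>0\<close> if
  \<open>N = 1\<close>. Extending it by zeros to a function turns appending a 0 into the mere replacement of
  \<open>N\<close> by \<open>N + 1\<close>.\<close>

definition binary_from_00 :: "nat \<Rightarrow> (nat \<Rightarrow> nat) \<Rightarrow> bool" where
  "binary_from_00 N v \<longleftrightarrow> 1 \<le> N \<and> v 0 = 0 \<and> v 1 = 0 \<and> (\<forall>i. v i \<le> 1) \<and> (\<forall>i \<ge> N. v i = 0)"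

text \<open>For \<open>s = 0\<close> this says that \<open>\<gamma>\<close> has the area vector \<open>v 0, \<dots>, v (N - 1)\<close>. In general it
  describes \<open>\<nu>\<^sup>s\<close> of that partition for \<open>s \<le> N\<close>: the top \<open>s\<close> rows belong to the partition with
  area vector \<open>v 0, \<dots>, v (N - 1), 0\<close>, and below them come the top rows of the original one.\<close>

definition window :: "nat \<Rightarrow> (nat \<Rightarrow> nat) \<Rightarrow> nat \<Rightarrow> nat list \<Rightarrow> bool" where
  "window N v s \<gamma> \<longleftrightarrow> \<gamma> \<in> Par \<and> (\<forall>j \<ge> 1. part \<gamma> j =
     (if j \<le> s then N + 1 - j - v (s + 1 - j) else N - j - v (N + s - j)))"

lemma binary_from_00D:
  assumes "binary_from_00 N v"
  shows "1 \<le> N" "v 0 = 0" "v 1 = 0" "v i \<le> 1" "N \<le> i \<Longrightarrow> v i = 0"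
  using assms unfolding binary_from_00_def by blast+

lemma binary_from_00_Suc: "binary_from_00 N v \<Longrightarrow> binary_from_00 (Suc N) v"
  by (auto simp: binary_from_00_def)

lemma length_window:
  assumes v: "binary_from_00 N v" and w: "window N v s \<gamma>" and s: "s < N"
  shows "length \<gamma> = N - 1 - v (s + 1)"
proof (rule length_eqI)
  show "\<gamma> \<in> Par" using w by (simp add: window_def)
  fix j :: nat assume j: "1 \<le> j"
  have 01: "v i = 0 \<or> v i = 1" for i
    using v by (auto simp: binary_from_00_def le_Suc_eq)
  note v0 = binary_from_00D(2,3)[OF v] binary_from_00D(5)[OF v order_refl]
  have p: "part \<gamma> j = (if j \<le> s then N + 1 - j - v (s + 1 - j) else N - j - v (N + s - j))"
    using w j by (simp add: window_def)
  consider "N \<le> j" | "j = N - 1" "s < j" | "j = N - 1" "j \<le> s" | "j < N - 1" by linarith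
  then show "0 < part \<gamma> j \<longleftrightarrow> j \<le> N - 1 - v (s + 1)"
  proof cases
    case 1
    with s p j 01[of "s + 1"] show ?thesis by auto
  next
    case 2
    with s p j 01[of "s + 1"] show ?thesis by auto
  next
    case 3
    \<comment> \<open>Here \<open>s = N - 1\<close>, and \<open>v\<close> vanishes at \<open>N\<close>.\<close>
    with s have "N = Suc s" by simp
    with 3 p v0 show ?thesis by simp
  next
    case 4
    have le1: "v i \<le> 1" for i using 01[of i] by auto
    have "0 < part \<gamma> j"
      using 4 p le1[of "s + 1 - j"] le1[of "N + s - j"] by (cases "j \<le> s") simp_all
    moreover have "j \<le> N - 1 - v (s + 1)" using 4 le1[of "s + 1"] by simp
    ultimately show ?thesis by simp
  qed
qed

text \<open>The part inserted by \<open>\<nu>\<close> is \<open>N - v (s + 1)\<close>, which is the next row of the partition of the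
  lengthened word; everything else moves down by one row.\<close>

lemma nu_window:
  assumes v: "binary_from_00 N v" and w: "window N v s \<gamma>" and s: "s < N"
  shows "nu_defined \<gamma>" and "window N v (Suc s) (nu \<gamma>)"
proof -
  have 01: "v i = 0 \<or> v i = 1" for i
    using v by (auto simp: binary_from_00_def le_Suc_eq)
  have p: "1 \<le> j \<Longrightarrow> part \<gamma> j = (if j \<le> s then N + 1 - j - v (s + 1 - j) else N - j - v (N + s - j))" for j
    using w by (simp add: window_def)
  show d: "nu_defined \<gamma>"
    using p[of 1] 01[of "s + 1"] by (auto simp: nu_defined_def length_window[OF assms])
  have par: "\<gamma> \<in> Par" using w by (simp add: window_def)
  show "window N v (Suc s) (nu \<gamma>)"
    unfolding window_def
  proof (intro conjI allI impI)
    show "nu \<gamma> \<in> Par" using par d by (rule nu_in_Par)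
    fix j :: nat assume "1 \<le> j"
    then consider "j = Suc 0" | i where "j = Suc i" "1 \<le> i" by (cases j; cases "j - 1") auto
    then show "part (nu \<gamma>) j = (if j \<le> Suc s then N + 1 - j - v (Suc s + 1 - j) else N - j - v (N + Suc s - j))"
    proof cases
      case 1
      \<comment> \<open>Makes the truncated subtractions exact; for \<open>N = 1\<close> it needs \<open>v N = 0\<close>.\<close>
    have "v (s + 1) \<le> N - 1"
      proof (cases "s + 1 = N")
        case False
        with s 01[of "s + 1"] show ?thesis by auto
      qed (use v in \<open>auto simp: binary_from_00_def\<close>)
      with 1 s show ?thesis by (simp add: part_nu(1)[OF par d] length_window[OF assms])
    next
      case 2
      with s show ?thesis by (simp add: part_nu(2)[OF par d] p)
    qed
  qed
qed

text \<open>After \<open>N\<close> steps the word has been lengthened by a 0 and the process repeats with \<open>N + 1\<close>.\<close>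

lemma window_full: "window N v N \<gamma> \<Longrightarrow> binary_from_00 N v \<Longrightarrow> window (Suc N) v 0 \<gamma>"
  unfolding window_def binary_from_00_def by (auto simp: not_le)

lemma min_Delta_window_0:
  assumes v: "binary_from_00 N v" and w: "window N v 0 \<gamma>"
  shows "min_Delta \<gamma> = N"
proof -
  note N = binary_from_00D(1,3)[OF v] and 01 = binary_from_00D(4)[OF v]
  have len: "length \<gamma> = N - 1" using length_window[OF assms] N by simp
  have par: "\<gamma> \<in> Par" using w by (simp add: window_def)
  have p: "1 \<le> j \<Longrightarrow> part \<gamma> j = N - j - v (N - j)" for j using w by (auto simp: window_def)
  have "min_Delta \<gamma> \<le> n \<longleftrightarrow> N \<le> n" for n
  proof (cases "N = 1")
    case True
    with len show ?thesis unfolding min_Delta_le_iff[OF par] by auto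
  next
    case False
    have "offset \<gamma> i \<le> N" if "i \<in> {1..N - 1}" for i
      using that p[of i] by (auto simp: offset_def)
    moreover have "offset \<gamma> (N - 1) = N" "N - 1 \<in> {1..N - 1}"
      using p[of "N - 1"] False N by (auto simp: offset_def)
    ultimately have "(\<forall>i \<in> {1..N - 1}. offset \<gamma> i \<le> n) \<longleftrightarrow> N \<le> n"
      by (metis le_trans)
    with N show ?thesis unfolding min_Delta_le_iff[OF par] len by auto
  qed
  then show ?thesis by (meson antisym order_refl)
qed

lemma nu_power_window:
  assumes v: "binary_from_00 N v" and w: "window N v 0 \<gamma>" and s: "s \<le> N"
  shows "window N v s ((nu ^^ s) \<gamma>)
    \<and> dinv ((nu ^^ s) \<gamma>) = dinv \<gamma> + s \<and> defc ((nu ^^ s) \<gamma>) = defc \<gamma>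
    \<and> min_Delta ((nu ^^ s) \<gamma>) = (if s = 0 then N else N + 1)"
  using s
proof (induction s)
  case 0
  with w min_Delta_window_0[OF v w] show ?case by simp
next
  case (Suc s)
  let ?\<delta> = "(nu ^^ s) \<gamma>"
  note N = binary_from_00D(1,3)[OF v] and 01 = binary_from_00D(4)[OF v]
  have IH: "window N v s ?\<delta>" "dinv ?\<delta> = dinv \<gamma> + s" "defc ?\<delta> = defc \<gamma>"
    "min_Delta ?\<delta> = (if s = 0 then N else N + 1)" using Suc by auto
  have s: "s < N" using Suc.prems by simp
  have par: "?\<delta> \<in> Par" using IH(1) by (simp add: window_def)
  note d = nu_window[OF v IH(1) s]
  have "min_Delta (nu ?\<delta>) \<le> n \<longleftrightarrow> N + 1 \<le> n" for n
    unfolding min_Delta_nu_le_iff[OF par d(1)] length_window[OF v IH(1) s] IH(4)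
    using N by auto
  then have "min_Delta (nu ?\<delta>) = N + 1" by (meson antisym order_refl)
  with d dinv_nu[OF par d(1)] defc_nu[OF par d(1)] IH show ?case by simp
qed

text \<open>The value of \<open>min_Delta\<close> is \<open>N\<close> at first, then \<open>N + 1\<close> for \<open>N\<close> steps, then \<open>N + 2\<close> for
  \<open>N + 1\<close> steps, and so on; it exceeds \<open>n\<close> after
  \<open>N + (N + 1) + \<dots> + (n - 1)\<close> steps, a difference of two binomial coefficients.\<close>

lemma nu_power_from_window:
  assumes "binary_from_00 N v" "window N v 0 \<gamma>"
  shows "(nu ^^ m) \<gamma> \<in> Par \<and> dinv ((nu ^^ m) \<gamma>) = dinv \<gamma> + m \<and> defc ((nu ^^ m) \<gamma>) = defc \<gamma>
    \<and> (\<forall>n. min_Delta ((nu ^^ m) \<gamma>) \<le> n \<longleftrightarrow> N \<le> n \<and> m + (N choose 2) \<le> n choose 2)"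
  using assms
proof (induction m arbitrary: N \<gamma> rule: less_induct)
  case (less m)
  have N: "1 \<le> N" using less.prems(1) by (rule binary_from_00D)
  have ch: "Suc N choose 2 = (N choose 2) + N" by (simp add: numeral_2_eq_2)
  show ?case
  proof (cases "m \<le> N")
    case True
    note * = nu_power_window[OF less.prems True]
    have "(if m = 0 then N else N + 1) \<le> n \<longleftrightarrow> N \<le> n \<and> m + (N choose 2) \<le> n choose 2" for n
    proof (cases "n \<le> N")
      case False
      then have "Suc N choose 2 \<le> n choose 2" by (intro binomial_right_mono) auto
      with False True ch show ?thesis by auto
    qed (auto simp: le_less)
    with * show ?thesis by (auto simp: window_def)
  next
    case False
    let ?\<delta> = "(nu ^^ N) \<gamma>"
    have m: "(nu ^^ m) \<gamma> = (nu ^^ (m - N)) ?\<delta>"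
      using False funpow_add[of "m - N" N nu] by simp
    note * = nu_power_window[OF less.prems order_refl]
    have w: "window (Suc N) v 0 ?\<delta>" using * less.prems window_full by blast
    have "m - N < m" using False N by simp
    note IH = less.IH[OF this binary_from_00_Suc[OF less.prems(1)] w]
    have "Suc N \<le> n \<and> m - N + (Suc N choose 2) \<le> n choose 2 \<longleftrightarrow> N \<le> n \<and> m + (N choose 2) \<le> n choose 2" for n
      using ch False by (cases "n = N") auto
    with IH * False show ?thesis unfolding m by auto
  qed
qed

section \<open>The statistics of tails\<close>

text \<open>The pairs of a 0 and a later 1 are those pairs of rows which are not attacking, see
  \<open>dinv_window_0\<close> below.\<close>

definition word_inv :: "nat list \<Rightarrow> nat" where
  "word_inv xs = card {(a, b). a < b \<and> b < length xs \<and> xs ! a = 0 \<and> xs ! b = 1}"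

lemma word_inv_snoc:
  "word_inv (xs @ [x]) = word_inv xs + (if x = 1 then count_list xs 0 else 0)"
proof -
  let ?n = "length xs"
  let ?A = "{(a, b). a < b \<and> b < ?n \<and> xs ! a = 0 \<and> xs ! b = 1}"
  let ?B = "if x = 1 then (\<lambda>a. (a, ?n)) ` {a. a < ?n \<and> 0 = xs ! a} else {}"
  have "p \<in> {(a, b). a < b \<and> b < length (xs @ [x]) \<and> (xs @ [x]) ! a = 0 \<and> (xs @ [x]) ! b = 1}
      \<longleftrightarrow> p \<in> ?A \<or> p \<in> ?B" for p
    by (cases p) (auto simp: nth_append less_Suc_eq)
  then have "{(a, b). a < b \<and> b < length (xs @ [x]) \<and> (xs @ [x]) ! a = 0 \<and> (xs @ [x]) ! b = 1}
      = ?A \<union> ?B" by (simp only: set_eq_iff Un_iff) simp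
  moreover have "finite ?A" by (rule finite_subset[of _ "{..<?n} \<times> {..<?n}"]) auto
  moreover have "card ?B = (if x = 1 then count_list xs 0 else 0)"
    by (simp add: card_image inj_on_def count_list_eq_length_filter length_filter_conv_card)
  moreover have "?A \<inter> ?B = {}" by auto
  ultimately show ?thesis unfolding word_inv_def by (simp add: card_Un_disjoint)
qed

lemma word_inv_append_ones: "word_inv (xs @ replicate n 1) = word_inv xs + n * count_list xs 0"
proof (induction n)
  case (Suc n)
  have "xs @ replicate (Suc n) 1 = (xs @ replicate n 1) @ [1]"
    by (simp add: replicate_append_same)
  then show ?case using Suc by (simp only: word_inv_snoc) simp
qed simp

definition block_word :: "(nat \<Rightarrow> nat) \<Rightarrow> nat \<Rightarrow> nat list" where
  "block_word f M = 0 # concat (map (\<lambda>i. 0 # replicate (f i) 1) [1..<M + 1])"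

lemma block_word_0 [simp]: "block_word f 0 = [0]"
  by (simp add: block_word_def)

lemma block_word_Suc: "block_word f (Suc M) = (block_word f M @ [0]) @ replicate (f (Suc M)) 1"
  by (simp add: block_word_def)

lemma length_block_word: "length (block_word f M) = M + 1 + (\<Sum>i = 1..M. f i)"
  by (induction M) (simp_all add: block_word_Suc)

lemma zeros_block_word: "count_list (block_word f M) 0 = M + 1"
proof -
  have "count_list (replicate n (1 :: nat)) 0 = 0" for n by (induction n) auto
  then show ?thesis by (induction M) (simp_all add: block_word_Suc)
qed

text \<open>A 1 in the block of index \<open>i\<close> comes after \<open>i + 1\<close> zeros: the initial one and one for each block
  up to its own.\<close>

lemma word_inv_block_word: "word_inv (block_word f M) = (\<Sum>i = 1..M. f i * (i + 1))"
proof (induction M)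
  case 0
  have empty: "{(a, b). a < b \<and> b < length [0] \<and> [0] ! a = (0 :: nat) \<and> [0] ! b = (1 :: nat)} = {}" by auto
  show ?case unfolding block_word_0 word_inv_def empty by simp
next
  case (Suc M)
  then show ?case
    unfolding block_word_Suc word_inv_append_ones word_inv_snoc by (simp add: zeros_block_word)
qed

lemma set_block_word: "set (block_word f M) \<subseteq> {0, 1}"
  by (auto simp: block_word_def)

lemma block_word_nth_1: "1 \<le> M \<Longrightarrow> block_word f M ! 1 = 0"
  by (simp add: block_word_def upt_conv_Cons del: upt_Suc)

text \<open>The number of zeros gives \<open>M\<close>. Every block begins with a 0, so the ones that follow the first
  zero of a block determine its length.\<close>

lemma block_word_inj:
  assumes "block_word f M = block_word g M'"
  shows "M = M'" and "\<And>i. i \<in> {1..M} \<Longrightarrow> f i = g i"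
proof -
  show M: "M = M'"
    using arg_cong[OF assms, of "\<lambda>xs. count_list xs 0"] by (simp add: zeros_block_word)
  let ?c = "\<lambda>h is. concat (map (\<lambda>i. 0 # replicate (h i) (1 :: nat)) is)"
  have "\<forall>i \<in> set is. f i = g i" if "?c f is = ?c g is" for "is"
    using that
  proof (induction "is")
    case (Cons i "is")
    have tw: "takeWhile ((=) 1) (replicate (h i) 1 @ ?c h is) = replicate (h i) 1" for h
    proof -
      have "takeWhile ((=) 1) (?c h is) = []" by (cases "is") auto
      then show ?thesis by (subst takeWhile_append2) auto
    qed
    from Cons.prems have eq: "replicate (f i) 1 @ ?c f is = replicate (g i) 1 @ ?c g is" by simp
    with tw[of f] tw[of g] have "replicate (f i) (1 :: nat) = replicate (g i) 1" by simp
    from arg_cong[OF this, of length] have "f i = g i" by simp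
    with eq Cons.IH show ?case by simp
  qed simp
  moreover have "?c f [1..<M + 1] = ?c g [1..<M + 1]" using assms M by (simp add: block_word_def)
  ultimately have "\<forall>i \<in> set [1..<M + 1]. f i = g i" by blast
  then show "f i = g i" if "i \<in> {1..M}" for i using that by (metis atLeastAtMost_iff atLeastLessThan_iff le_imp_less_Suc Suc_eq_plus1 set_upt)
qed

lemma TI_vec_block_word: "TI_vec \<mu> = block_word (count_list \<mu>) (part \<mu> 1)"
  by (simp add: TI_vec_def block_word_def)

lemma set_Par_subset: "\<mu> \<in> Par \<Longrightarrow> set \<mu> \<subseteq> {1..part \<mu> 1}"
proof
  fix x assume \<mu>: "\<mu> \<in> Par" and "x \<in> set \<mu>"
  then obtain i where i: "i < length \<mu>" "x = \<mu> ! i" by (auto simp: in_set_conv_nth)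
  then have "x = part \<mu> (Suc i)" by (simp add: part_nth)
  with \<mu> i show "x \<in> {1..part \<mu> 1}"
    using part_antimono[OF \<mu>, of 1 "Suc i"] part_pos[OF \<mu>, of "Suc i"] by auto
qed

lemma sum_count_list_Par:
  assumes "\<mu> \<in> Par"
  shows "(\<Sum>i = 1..part \<mu> 1. count_list \<mu> i * h i) = sum_list (map h \<mu>)"
proof -
  have "(\<Sum>i = 1..part \<mu> 1. count_list \<mu> i * h i) = (\<Sum>i \<in> set \<mu>. count_list \<mu> i * h i)"
    using set_Par_subset[OF assms] by (intro sum.mono_neutral_right) (auto simp: count_list_0_iff)
  then show ?thesis by (simp add: sum_list_map_eq_sum_count)
qed

definition TI_size :: "nat list \<Rightarrow> nat" where
  "TI_size \<mu> = part \<mu> 1 + length \<mu> + 1"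

definition TI_fun :: "nat list \<Rightarrow> nat \<Rightarrow> nat" where
  "TI_fun \<mu> i = (if i < TI_size \<mu> then TI_vec \<mu> ! i else 0)"

lemma length_TI_vec: "\<mu> \<in> Par \<Longrightarrow> length (TI_vec \<mu>) = TI_size \<mu>"
  using sum_count_list_Par[of \<mu> "\<lambda>_. 1"]
  by (simp add: TI_vec_block_word length_block_word TI_size_def sum_list_triv)

lemma binary_TI_fun:
  assumes "\<mu> \<in> Par"
  shows "binary_from_00 (TI_size \<mu>) (TI_fun \<mu>)"
  unfolding binary_from_00_def
proof (intro conjI allI impI)
  show "1 \<le> TI_size \<mu>" by (simp add: TI_size_def)
  show "TI_fun \<mu> 0 = 0" by (simp add: TI_fun_def TI_vec_def)
  show "TI_fun \<mu> 1 = 0"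
  proof (cases "\<mu> = []")
    case True
    then show ?thesis by (simp add: TI_fun_def TI_size_def part_def)
  next
    case False
    then have "1 \<le> part \<mu> 1" using part_pos[OF assms, of 1] by (cases \<mu>) auto
    then show ?thesis by (simp only: TI_fun_def TI_vec_block_word block_word_nth_1) simp
  qed
  show "TI_fun \<mu> i \<le> 1" for i
  proof (cases "i < TI_size \<mu>")
    case True
    then have "TI_vec \<mu> ! i \<in> set (TI_vec \<mu>)" using length_TI_vec[OF assms] by simp
    then have "TI_vec \<mu> ! i \<in> {0, 1}"
      using set_block_word[of "count_list \<mu>" "part \<mu> 1"] by (auto simp: TI_vec_block_word)
    then show ?thesis by (auto simp: TI_fun_def)
  qed (simp add: TI_fun_def)
  show "TI_fun \<mu> i = 0" if "TI_size \<mu> \<le> i" for i using that by (simp add: TI_fun_def)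
qed

lemma window_TI:
  assumes "\<mu> \<in> Par"
  shows "window (TI_size \<mu>) (TI_fun \<mu>) 0 (TI \<mu>)"
proof -
  let ?N = "TI_size \<mu>" and ?v = "TI_fun \<mu>"
  let ?xs = "map (\<lambda>j. ?N - j - ?v (?N - j)) [1..<?N + 1]"
  have N: "1 \<le> ?N" by (simp add: TI_size_def)
  have "TI \<mu> = filter ((<) 0) (map (\<lambda>j. ?N - j - TI_vec \<mu> ! (?N - j)) [1..<?N + 1])"
    unfolding TI_def TI_size_def by (simp add: Let_def)
  also have "map (\<lambda>j. ?N - j - TI_vec \<mu> ! (?N - j)) [1..<?N + 1] = ?xs"
    by (rule map_cong) (auto simp: TI_fun_def)
  finally have TI: "TI \<mu> = filter ((<) 0) ?xs" .
  have nth: "?xs ! i = ?N - Suc i - ?v (?N - Suc i)" if "i < ?N" for i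
    using that by (simp del: upt_Suc)
  have sorted: "sorted_wrt (\<ge>) ?xs"
    unfolding sorted_wrt_iff_nth_less
  proof (intro allI impI)
    fix i j assume ij: "i < j" "j < length ?xs"
    then have j: "j < ?N" by (simp del: upt_Suc)
    show "?xs ! j \<le> ?xs ! i"
      using nth[of i] nth[of j] ij(1) j binary_from_00D(4)[OF binary_TI_fun[OF assms], of "?N - Suc i"]
      by (simp del: upt_Suc)
  qed
  have "part (TI \<mu>) j = ?N - j - ?v (?N - j)" if "1 \<le> j" for j
  proof (cases "j \<le> ?N")
    case True
    then have "part ?xs j = ?xs ! (j - 1)" using that by (simp add: part_def del: upt_Suc)
    also have "\<dots> = ?N - j - ?v (?N - j)" using nth[of "j - 1"] True that by (simp del: upt_Suc)
    finally show ?thesis unfolding TI part_filter_pos[OF sorted] .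
  next
    case False
    then have "part ?xs j = 0" by (simp add: part_def del: upt_Suc)
    with False show ?thesis unfolding TI part_filter_pos[OF sorted] by simp
  qed
  moreover have "TI \<mu> \<in> Par" unfolding TI using sorted by (rule filter_pos_in_Par)
  ultimately show ?thesis by (simp add: window_def)
qed

lemma sum_lessThan_eq_choose: "(\<Sum>i<N. i) = N choose 2"
  by (induction N) (simp_all add: numeral_2_eq_2)

lemma card_pairs_less: "card {(a, b). a < b \<and> b < (N :: nat)} = N choose 2"
proof -
  have "{(a, b). a < b \<and> b < N} = (\<lambda>(b, a). (a, b)) ` (SIGMA b:{..<N}. {..<b})" by auto
  then have "card {(a, b). a < b \<and> b < N} = card (SIGMA b:{..<N}. {..<b})"
    by (simp add: card_image inj_on_def)
  also have "\<dots> = (\<Sum>b<N. b)" by simp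
  also have "\<dots> = N choose 2" by (rule sum_lessThan_eq_choose)
  finally show ?thesis .
qed

text \<open>All offsets of rows up to \<open>N\<close> are \<open>N\<close> or \<open>N - 1\<close>, so two such rows attack each other unless
  the upper one has the smaller offset. Rows below \<open>N\<close> are too far away to be attacked.\<close>

lemma dinv_window_0:
  assumes v: "binary_from_00 N v" and w: "window N v 0 \<gamma>"
  shows "dinv \<gamma> + card {(a, b). a < b \<and> b < N \<and> v a = 0 \<and> v b = 1} = N choose 2"
proof -
  let ?inv = "{(a, b). a < b \<and> b < N \<and> v a = 0 \<and> v b = 1}"
  let ?non = "{(a, b). a < b \<and> b < N \<and> \<not> (v a = 0 \<and> v b = 1)}"
  note v0 = binary_from_00D(2)[OF v] and le1 = binary_from_00D(4)[OF v]
  have par: "\<gamma> \<in> Par" using w by (simp add: window_def)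
  have off: "offset \<gamma> j = (if j \<le> N then N - v (N - j) else j)" if "1 \<le> j" for j
  proof -
    have "j + v (N - j) \<le> N" if "j \<le> N"
      using that v0 le1[of "N - j"] by (cases "j = N") auto
    moreover have "part \<gamma> j = N - j - v (N - j)" using that w by (simp add: window_def)
    ultimately show ?thesis by (auto simp: offset_def)
  qed
  have att: "(i, j) \<in> attack_pairs \<gamma> \<longleftrightarrow> 1 \<le> i \<and> i < j \<and> j \<le> N \<and> \<not> (v (N - j) = 0 \<and> v (N - i) = 1)" for i j
  proof (cases "1 \<le> i \<and> i < j")
    case True
    have "j \<le> offset \<gamma> j" by (simp add: offset_def)
    moreover have "v (N - i) = 0 \<or> v (N - i) = 1" "v (N - j) = 0 \<or> v (N - j) = 1"
      using le1[of "N - i"] le1[of "N - j"] by auto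
    ultimately show ?thesis
      using True off[of i] off[of j]
      by (cases "i \<le> N"; cases "j \<le> N") (auto simp: attack_pairs_def)
  qed (auto simp: attack_pairs_def)
  have "bij_betw (\<lambda>(i, j). (N - j, N - i)) (attack_pairs \<gamma>) ?non"
  proof (rule bij_betwI[where g = "\<lambda>(a, b). (N - b, N - a)"])
    show "(\<lambda>(i, j). (N - j, N - i)) \<in> attack_pairs \<gamma> \<rightarrow> ?non"
    proof (clarify)
      fix i j assume "(i, j) \<in> attack_pairs \<gamma>"
      then have "1 \<le> i" "i < j" "j \<le> N" "\<not> (v (N - j) = 0 \<and> v (N - i) = 1)"
        unfolding att by blast+
      moreover from this have "N - j < N - i" "N - i < N" by linarith+
      ultimately show "N - j < N - i \<and> N - i < N \<and> \<not> (v (N - j) = 0 \<and> v (N - i) = 1)" by blast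
    qed
    show "(\<lambda>(a, b). (N - b, N - a)) \<in> ?non \<rightarrow> attack_pairs \<gamma>"
    proof (clarify)
      fix a b assume *: "a < b" "b < N" "\<not> (v a = 0 \<and> v b = 1)"
      then have "N - (N - a) = a" "N - (N - b) = b" "1 \<le> N - b" "N - b < N - a" "N - a \<le> N"
        by linarith+
      with * show "(N - b, N - a) \<in> attack_pairs \<gamma>" unfolding att by simp
    qed
    show "(\<lambda>(a, b). (N - b, N - a)) ((\<lambda>(i, j). (N - j, N - i)) p) = p"
      if "p \<in> attack_pairs \<gamma>" for p
    proof -
      obtain i j where p: "p = (i, j)" by (cases p)
      with that have "i < j" "j \<le> N" unfolding p att by blast+
      then show ?thesis by (simp add: p)
    qed
    show "(\<lambda>(i, j). (N - j, N - i)) ((\<lambda>(a, b). (N - b, N - a)) p) = p" if "p \<in> ?non" for p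
      using that by (cases p) simp
  qed
  then have "dinv \<gamma> = card ?non"
    unfolding dinv_eq_card_attack_pairs[OF par] by (rule bij_betw_same_card)
  then have "dinv \<gamma> + card ?inv = card ?non + card ?inv" by (rule arg_cong)
  also have "\<dots> = card (?non \<union> ?inv)"
  proof (rule card_Un_disjoint[symmetric])
    show "finite ?non" "finite ?inv" by (rule finite_subset[of _ "{..<N} \<times> {..<N}"]; auto)+
  qed auto
  also have "?non \<union> ?inv = {(a, b). a < b \<and> b < N}" by auto
  finally show ?thesis unfolding card_pairs_less .
qed

lemma dinv_TI:
  assumes "\<mu> \<in> Par"
  shows "dinv (TI \<mu>) + length \<mu> + sum_list \<mu> = TI_size \<mu> choose 2"
proof -
  have "{(a, b). a < b \<and> b < TI_size \<mu> \<and> TI_fun \<mu> a = 0 \<and> TI_fun \<mu> b = 1}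
    = {(a, b). a < b \<and> b < length (TI_vec \<mu>) \<and> TI_vec \<mu> ! a = 0 \<and> TI_vec \<mu> ! b = 1}"
    by (auto simp: TI_fun_def length_TI_vec[OF assms])
  then have "dinv (TI \<mu>) + word_inv (TI_vec \<mu>) = TI_size \<mu> choose 2"
    using dinv_window_0[OF binary_TI_fun[OF assms] window_TI[OF assms]] by (simp add: word_inv_def)
  moreover have "word_inv (TI_vec \<mu>) = length \<mu> + sum_list \<mu>"
    using sum_count_list_Par[OF assms, of "\<lambda>i. i + 1"]
    by (simp add: TI_vec_block_word word_inv_block_word sum_list_Suc)
  ultimately show ?thesis by simp
qed

lemma sum_list_window_0:
  assumes v: "binary_from_00 N v" and w: "window N v 0 \<gamma>"
  shows "sum_list \<gamma> + (\<Sum>i<N. v i) = N choose 2"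
proof -
  note v0 = binary_from_00D(2)[OF v] and le1 = binary_from_00D(4)[OF v]
  have len: "length \<gamma> = N - 1"
    using length_window[OF v w] binary_from_00D(1,3)[OF v] by simp
  have "sum_list \<gamma> = (\<Sum>j = 1..length \<gamma>. part \<gamma> j)" by (rule sum_list_eq_sum_part)
  also have "\<dots> = (\<Sum>j = 1..N - 1. N - j - v (N - j))"
    using w by (intro sum.cong) (auto simp: window_def len)
  also have "\<dots> = (\<Sum>i = 1..N - 1. i - v i)"
    by (rule sum.reindex_bij_witness[where i = "\<lambda>i. N - i" and j = "\<lambda>i. N - i"]) auto
  finally have "sum_list \<gamma> = (\<Sum>i = 1..N - 1. i - v i)" .
  moreover have "(\<Sum>i = 1..N - 1. i - v i) + (\<Sum>i = 1..N - 1. v i) = (\<Sum>i = 1..N - 1. i)"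
    unfolding sum.distrib[symmetric]
  proof (rule sum.cong)
    show "i - v i + v i = i" if "i \<in> {1..N - 1}" for i
      using that le1[of i] by simp
  qed simp
  moreover have "(\<Sum>i<N. h i) = h 0 + (\<Sum>i = 1..N - 1. h i)" for h :: "nat \<Rightarrow> nat"
  proof -
    have "{..<N} = insert 0 {1..N - 1}" using binary_from_00D(1)[OF v] by auto
    then show ?thesis by simp
  qed
  from this[of v] this[of "\<lambda>i. i"]
  have "(\<Sum>i<N. v i) = (\<Sum>i = 1..N - 1. v i)" "(\<Sum>i<N. i) = (\<Sum>i = 1..N - 1. i)"
    using v0 by simp_all
  ultimately show ?thesis using sum_lessThan_eq_choose[of N] by simp
qed

lemma sum_list_block_word: "sum_list (block_word f M) = (\<Sum>i = 1..M. f i)"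
  by (induction M) (simp_all add: block_word_Suc sum_list_replicate)

lemma defc_TI:
  assumes "\<mu> \<in> Par"
  shows "defc (TI \<mu>) = sum_list \<mu>"
proof -
  have "(\<Sum>i<TI_size \<mu>. TI_fun \<mu> i) = sum_list (TI_vec \<mu>)"
    unfolding sum_list_sum_nth length_TI_vec[OF assms]
    by (rule sum.cong) (auto simp: TI_fun_def)
  also have "\<dots> = length \<mu>"
    using sum_count_list_Par[OF assms, of "\<lambda>_. 1"]
    by (simp add: TI_vec_block_word sum_list_block_word sum_list_triv)
  finally show ?thesis
    using sum_list_window_0[OF binary_TI_fun[OF assms] window_TI[OF assms]]
      dinv_TI[OF assms] dinv_plus_defc[of "TI \<mu>"] by simp
qed

lemma min_Delta_TI: "\<mu> \<in> Par \<Longrightarrow> min_Delta (TI \<mu>) = TI_size \<mu>"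
  by (rule min_Delta_window_0[OF binary_TI_fun window_TI])

text \<open>Since \<open>min_Delta\<close> gives the length of the vector, the parts of \<open>TI \<mu>\<close> give its entries. The
  entries determine how often each number occurs as a part of \<open>\<mu>\<close>.\<close>

lemma TI_inj:
  assumes "\<mu> \<in> Par" "\<rho> \<in> Par" "TI \<mu> = TI \<rho>"
  shows "\<mu> = \<rho>"
proof -
  let ?N = "TI_size \<mu>"
  have N: "TI_size \<rho> = ?N" using min_Delta_TI[OF assms(1)] min_Delta_TI[OF assms(2)] assms(3) by simp
  note v = binary_TI_fun[OF assms(1)] binary_TI_fun[OF assms(2), unfolded N]
  note w = window_TI[OF assms(1)] window_TI[OF assms(2), unfolded N]
  have same: "TI_fun \<mu> i = TI_fun \<rho> i" if "i < ?N" for i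
  proof (cases "i = 0")
    case True
    then show ?thesis using binary_from_00D(2)[OF v(1)] binary_from_00D(2)[OF v(2)] by simp
  next
    case False
    have "part (TI \<mu>) (?N - i) = i - TI_fun \<mu> i"
      using w(1) that by (simp add: window_def)
    moreover have "part (TI \<rho>) (?N - i) = i - TI_fun \<rho> i"
      using w(2) that by (simp add: window_def)
    ultimately show ?thesis
      using assms(3) False binary_from_00D(4)[OF v(1), of i] binary_from_00D(4)[OF v(2), of i] by simp
  qed
  have "TI_vec \<mu> = TI_vec \<rho>"
  proof (rule nth_equalityI)
    show "length (TI_vec \<mu>) = length (TI_vec \<rho>)" using assms N by (simp add: length_TI_vec)
    show "TI_vec \<mu> ! i = TI_vec \<rho> ! i" if "i < length (TI_vec \<mu>)" for i
      using same[of i] that assms N by (simp add: length_TI_vec TI_fun_def)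
  qed
  note inj = block_word_inj[OF this[unfolded TI_vec_block_word]]
  have "count_list \<mu> x = count_list \<rho> x" for x
  proof (cases "x \<in> {1..part \<mu> 1}")
    case True
    then show ?thesis by (rule inj(2))
  next
    case False
    then have "x \<notin> set \<mu>" "x \<notin> set \<rho>"
      using set_Par_subset[OF assms(1)] set_Par_subset[OF assms(2)] inj(1) by auto
    then show ?thesis by (simp add: count_list_0_iff)
  qed
  then have "mset (rev \<mu>) = mset (rev \<rho>)" by (intro multiset_eqI) (simp add: count_mset)
  moreover have "sorted (rev \<mu>)" "sorted (rev \<rho>)" using assms by (auto simp: Par_def sorted_wrt_rev)
  ultimately have "sort (rev \<rho>) = rev \<mu>" "sort (rev \<rho>) = rev \<rho>"
    by (blast intro: properties_for_sort)+
  then show ?thesis by simp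
qed

text \<open>By the last claim, which rests on \<open>dinv_TI\<close>, a tail behaves like an ordinary chain whose
  opposite has a right part starting at \<open>dinv = \<ell>(\<mu>)\<close>.\<close>

lemma tail_properties:
  assumes "\<mu> \<in> Par"
  shows "(nu ^^ m) (TI \<mu>) \<in> Par" and "dinv ((nu ^^ m) (TI \<mu>)) = dinv (TI \<mu>) + m"
    and "defc ((nu ^^ m) (TI \<mu>)) = sum_list \<mu>"
    and "min_Delta ((nu ^^ m) (TI \<mu>)) \<le> n \<longleftrightarrow> min_Delta (TI \<mu>) \<le> n
      \<and> dinv ((nu ^^ m) (TI \<mu>)) + sum_list \<mu> + length \<mu> \<le> n choose 2"
proof -
  note * = nu_power_from_window[OF binary_TI_fun[OF assms] window_TI[OF assms], of m]
  from * show "(nu ^^ m) (TI \<mu>) \<in> Par" and d: "dinv ((nu ^^ m) (TI \<mu>)) = dinv (TI \<mu>) + m"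
    by blast+
  from * show "defc ((nu ^^ m) (TI \<mu>)) = sum_list \<mu>" unfolding defc_TI[OF assms] by blast
  have "min_Delta ((nu ^^ m) (TI \<mu>)) \<le> n \<longleftrightarrow> TI_size \<mu> \<le> n \<and> m + (TI_size \<mu> choose 2) \<le> n choose 2"
    using * by blast
  then show "min_Delta ((nu ^^ m) (TI \<mu>)) \<le> n \<longleftrightarrow> min_Delta (TI \<mu>) \<le> n
      \<and> dinv ((nu ^^ m) (TI \<mu>)) + sum_list \<mu> + length \<mu> \<le> n choose 2"
    unfolding d min_Delta_TI[OF assms] dinv_TI[OF assms, symmetric] by (simp add: ac_simps)
qed

lemma TI_in_tail: "TI \<mu> \<in> tail \<mu>"
  unfolding tail_def by (rule CollectI, rule exI[of _ 0]) simp

lemma tail_inj: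
  assumes "\<mu> \<in> Par" "\<rho> \<in> Par" "tail \<mu> = tail \<rho>"
  shows "\<mu> = \<rho>"
proof (rule TI_inj[OF assms(1,2)])
  have "TI \<mu> \<in> tail \<rho>" "TI \<rho> \<in> tail \<mu>"
    using assms(3) TI_in_tail by blast+
  then obtain m m' where *: "TI \<mu> = (nu ^^ m) (TI \<rho>)" "TI \<rho> = (nu ^^ m') (TI \<mu>)"
    unfolding tail_def by blast
  have "dinv (TI \<mu>) = dinv (TI \<rho>) + m"
    by (subst *(1)) (rule tail_properties(2)[OF assms(2)])
  moreover have "dinv (TI \<rho>) = dinv (TI \<mu>) + m'"
    by (subst *(2)) (rule tail_properties(2)[OF assms(1)])
  ultimately have "m = 0" by simp
  with *(1) show "TI \<mu> = TI \<rho>" by simp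
qed

section \<open>Staircases\<close>

lemma sum_shift_eq_choose: "(\<Sum>r<d. h + r) + (h choose 2) = (h + d) choose 2"
  by (induction d) (simp_all add: numeral_2_eq_2)

text \<open>Values up to \<open>n\<close> are taken \<open>(m + 1) + h + (h + 1) + \<dots> + (n - 1)\<close> times.\<close>

lemma staircase_le_iff:
  "staircase a m h i \<le> n \<longleftrightarrow> h \<le> n \<and> i + (h choose 2) < a + m + 1 + (n choose 2)"
proof -
  let ?P = "\<lambda>j. i < a + (m + 1) + (\<Sum>r<j. h + r)"
  have mono: "?P j \<Longrightarrow> j \<le> j' \<Longrightarrow> ?P j'" for j j'
    by (rule order.strict_trans2, assumption) (auto intro: sum_mono2)
  have "i \<le> (\<Sum>r<Suc i. h + r)" by simp
  then have "?P (Suc i)" by simp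
  then have least: "?P (LEAST j. ?P j)" by (rule LeastI)
  have "staircase a m h i \<le> n \<longleftrightarrow> h \<le> n \<and> ?P (n - h)"
  proof (cases "h \<le> n")
    case True
    then have "staircase a m h i \<le> n \<longleftrightarrow> (LEAST j. ?P j) \<le> n - h" by (auto simp: staircase_def)
    also have "\<dots> \<longleftrightarrow> ?P (n - h)" using mono[OF least] Least_le[of ?P] by blast
    finally show ?thesis using True by simp
  qed (simp add: staircase_def)
  also have "\<dots> \<longleftrightarrow> h \<le> n \<and> i + (h choose 2) < a + m + 1 + (n choose 2)"
    using sum_shift_eq_choose[of h "n - h"] by auto
  finally show ?thesis .
qed

lemma staircase_mono: "i \<le> j \<Longrightarrow> staircase a m h i \<le> staircase a m h j"
  using staircase_le_iff[of a m h j "staircase a m h j"]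
    staircase_le_iff[of a m h i "staircase a m h j"] by simp

lemma staircase_plateau: "staircase a m h i \<le> h \<longleftrightarrow> i \<le> a + m"
  by (auto simp: staircase_le_iff)

lemma staircase_ge: "h \<le> staircase a m h i"
  by (simp add: staircase_def)

section \<open>Local chains\<close>

text \<open>The parameters of a chain, as functions of its left and right part alone. In this form they carry
  over without further ado when the right part of one chain is the left part of another.\<close>

definition low :: "nat list set \<Rightarrow> nat" where
  "low X = Inf (dinv ` X)"

definition high :: "nat list set \<Rightarrow> nat" where
  "high X = Max (dinv ` X)"

definition height :: "nat list set \<Rightarrow> nat" where
  "height X = Inf (min_Delta ` X)"

lemma low_high_eq:
  assumes "dinv ` X = {a..b}" "a \<le> b"
  shows "low X = a" "high X = b"
  using assms by (auto simp: low_def high_def intro!: Max_eqI)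

lemma height_eq:
  assumes "X \<noteq> {}" "\<And>\<gamma>. \<gamma> \<in> X \<Longrightarrow> min_Delta \<gamma> = h"
  shows "height X = h"
proof -
  have "min_Delta ` X = {h}" using assms by auto
  then show ?thesis by (simp add: height_def)
qed

lemma low_le: "\<gamma> \<in> X \<Longrightarrow> low X \<le> dinv \<gamma>"
  unfolding low_def by (intro cInf_lower) auto

text \<open>These properties no longer mention an enumeration of the chain, so they can be compared for two
  presentations of the same set.\<close>

lemma ordinary_shapeD:
  assumes "ordinary_shape S a a' m m' h h'"
  shows "a + m + 1 < a'" and "S \<subseteq> Par" and "inj_on dinv S" and "dinv ` S = {a..a' + m'}"
    and "\<And>\<gamma>. \<gamma> \<in> S \<Longrightarrow> dinv \<gamma> < a' \<Longrightarrow> min_Delta \<gamma> = staircase a m h (dinv \<gamma>)"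
    and "\<And>\<gamma>. \<gamma> \<in> S \<Longrightarrow> a' \<le> dinv \<gamma> \<Longrightarrow> min_Delta \<gamma> = h'"
    and "\<And>\<gamma>. \<gamma> \<in> S \<Longrightarrow> Suc (dinv \<gamma>) = a' \<Longrightarrow> h' < min_Delta \<gamma>"
proof -
  from assms obtain \<gamma> where aa: "a + m + 1 < a'" and S: "S = \<gamma> ` {a..a' + m'}"
    and \<gamma>: "\<forall>i \<in> {a..a' + m'}. \<gamma> i \<in> Par \<and> dinv (\<gamma> i) = i"
    and desc: "min_Delta (\<gamma> (a' - 1)) > min_Delta (\<gamma> a')"
    and right: "\<forall>i \<in> {a'..a' + m'}. min_Delta (\<gamma> i) = h'"
    and left: "\<forall>i \<in> {a..a' - 1}. min_Delta (\<gamma> i) = staircase a m h i"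
    unfolding ordinary_shape_def by blast
  show "a + m + 1 < a'" by (rule aa)
  show "S \<subseteq> Par" using S \<gamma> by blast
  show "inj_on dinv S" unfolding S by (rule inj_onI) (use \<gamma> in \<open>metis (no_types, lifting) imageE\<close>)
  have "(\<lambda>i. dinv (\<gamma> i)) ` {a..a' + m'} = (\<lambda>i. i) ` {a..a' + m'}"
    using \<gamma> by (intro image_cong refl) blast
  then show "dinv ` S = {a..a' + m'}" unfolding S image_image by simp
  fix \<delta> assume "\<delta> \<in> S"
  then obtain i where i: "i \<in> {a..a' + m'}" "\<delta> = \<gamma> i" "dinv \<delta> = i" using S \<gamma> by blast
  show "min_Delta \<delta> = staircase a m h (dinv \<delta>)" if "dinv \<delta> < a'" using i that left by simp
  show "min_Delta \<delta> = h'" if "a' \<le> dinv \<delta>" using i that right by simp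
  show "h' < min_Delta \<delta>" if "Suc (dinv \<delta>) = a'"
  proof -
    have "a' - 1 = i" using that i by simp
    then show ?thesis using desc right i by simp
  qed
qed

lemma ordinary_shape_member:
  assumes "ordinary_shape S a a' m m' h h'" "a \<le> i" "i \<le> a' + m'"
  shows "\<exists>\<gamma> \<in> S. dinv \<gamma> = i"
proof -
  have "i \<in> dinv ` S" unfolding ordinary_shapeD(4)[OF assms(1)] using assms by simp
  then show ?thesis by blast
qed

text \<open>A staircase never descends, so the descent at \<open>a'\<close> cannot lie inside the staircase of the other
  presentation.\<close>

lemma ordinary_shape_descent_unique:
  assumes "ordinary_shape S a a' m m' h h'" "ordinary_shape S b b' l l' g g'"
  shows "b' \<le> a'"
proof (rule ccontr)
  assume "\<not> b' \<le> a'"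
  note A = ordinary_shapeD[OF assms(1)] and B = ordinary_shapeD[OF assms(2)]
  have "a \<le> a' - 1" "a' - 1 \<le> a' + m'" using A(1) by auto
  from ordinary_shape_member[OF assms(1) this]
  obtain \<gamma> where \<gamma>: "\<gamma> \<in> S" "dinv \<gamma> = a' - 1" by blast
  obtain \<delta> where \<delta>: "\<delta> \<in> S" "dinv \<delta> = a'"
    using ordinary_shape_member[OF assms(1), of a'] A(1) by auto
  have "min_Delta \<delta> < min_Delta \<gamma>" using A(6)[of \<delta>] A(7)[of \<gamma>] A(1) \<gamma> \<delta> by simp
  moreover have "min_Delta \<gamma> \<le> min_Delta \<delta>"
    using B(5)[of \<gamma>] B(5)[of \<delta>] \<gamma> \<delta> \<open>\<not> b' \<le> a'\<close> staircase_mono[of "a' - 1" a' b l g] by simp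
  ultimately show False by simp
qed

lemma ordinary_shape_plateau_unique:
  assumes "ordinary_shape S a a' m m' h h'" "ordinary_shape S a a' l l' g g'"
  shows "h = g" and "m \<le> l"
proof -
  note A = ordinary_shapeD[OF assms(1)] and B = ordinary_shapeD[OF assms(2)]
  have start: "staircase a m h a = h" for m h
    using staircase_plateau[of a m h a] staircase_ge[of h a m a] by simp
  obtain \<gamma> where "\<gamma> \<in> S" "dinv \<gamma> = a"
    using ordinary_shape_member[OF assms(1), of a] A(1) by auto
  then show hg: "h = g" using A(1) A(5)[of \<gamma>] B(5)[of \<gamma>] start by simp
  show "m \<le> l"
  proof (rule ccontr)
    assume "\<not> m \<le> l"
    obtain \<delta> where \<delta>: "\<delta> \<in> S" "dinv \<delta> = a + m"
      using ordinary_shape_member[OF assms(1), of "a + m"] A(1) by auto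
    then have "staircase a m h (a + m) = staircase a l g (a + m)"
      using A(1) A(5)[of \<delta>] B(5)[of \<delta>] by simp
    then show False
      using staircase_plateau[of a m h "a + m"] staircase_plateau[of a l g "a + m"] hg
        \<open>\<not> m \<le> l\<close> by simp
  qed
qed

lemma ordinary_shape_unique:
  assumes "ordinary_shape S a a' m m' h h'" "ordinary_shape S b b' l l' g g'"
  shows "b = a \<and> b' = a' \<and> l = m \<and> l' = m' \<and> g = h \<and> g' = h'"
proof -
  note A = ordinary_shapeD[OF assms(1)] and B = ordinary_shapeD[OF assms(2)]
  have "{a..a' + m'} = {b..b' + l'}" by (rule trans[OF A(4)[symmetric] B(4)])
  then have ab: "b = a" "b' + l' = a' + m'" using A(1) B(1) unfolding Icc_eq_Icc by auto
  have desc: "b' = a'"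
    using ordinary_shape_descent_unique[OF assms] ordinary_shape_descent_unique[OF assms(2,1)] by simp
  have B': "ordinary_shape S a a' l l' g g'" using assms(2) ab(1) desc by simp
  have "g = h" "l = m"
    using ordinary_shape_plateau_unique[OF assms(1) B'] ordinary_shape_plateau_unique[OF B' assms(1)]
    by simp_all
  moreover obtain \<gamma> where "\<gamma> \<in> S" "dinv \<gamma> = a'"
    using ordinary_shape_member[OF assms(1), of a'] A(1) by auto
  then have "g' = h'" using A(6)[of \<gamma>] B(6)[of \<gamma>] desc by simp
  ultimately show ?thesis using ab desc by simp
qed

lemma dinv_tail: "\<mu> \<in> Par \<Longrightarrow> dinv ` tail \<mu> = {dinv (TI \<mu>)..}"
proof
  assume \<mu>: "\<mu> \<in> Par"
  show "dinv ` tail \<mu> \<subseteq> {dinv (TI \<mu>)..}"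
    using tail_properties(2)[OF \<mu>] by (auto simp: tail_def)
  show "{dinv (TI \<mu>)..} \<subseteq> dinv ` tail \<mu>"
  proof
    fix i assume "i \<in> {dinv (TI \<mu>)..}"
    then have "i = dinv ((nu ^^ (i - dinv (TI \<mu>))) (TI \<mu>))"
      using tail_properties(2)[OF \<mu>] by simp
    then show "i \<in> dinv ` tail \<mu>" unfolding tail_def by blast
  qed
qed

lemma inj_on_dinv_tail: "\<mu> \<in> Par \<Longrightarrow> inj_on dinv (tail \<mu>)"
  using tail_properties(2)[of \<mu>] by (auto simp: tail_def inj_on_def)

lemma infinite_tail: "\<mu> \<in> Par \<Longrightarrow> infinite (tail \<mu>)"
proof
  assume "\<mu> \<in> Par" "finite (tail \<mu>)"
  then have "finite {dinv (TI \<mu>)..}" using dinv_tail[of \<mu>] by (metis finite_imageI)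
  then show False by (simp add: infinite_Ici)
qed

lemma ordinary_not_exceptional:
  assumes "ordinary_shape S a a' m m' h h'"
  shows "\<mu> \<in> Par \<Longrightarrow> S \<noteq> tail \<mu>" and "S \<noteq> {\<gamma>}"
proof -
  note A = ordinary_shapeD[OF assms]
  have "finite S" using A(3,4) by (metis finite_atLeastAtMost finite_imageD)
  then show "\<mu> \<in> Par \<Longrightarrow> S \<noteq> tail \<mu>" using infinite_tail by blast
  show "S \<noteq> {\<gamma>}"
  proof
    assume "S = {\<gamma>}"
    with A(4) have "{a..a' + m'} = {dinv \<gamma>}" by simp
    moreover have "a \<in> {a..a' + m'}" "a' \<in> {a..a' + m'}" using A(1) by auto
    ultimately show False using A(1) by auto
  qed
qed

lemma parts_ordinary:
  assumes "ordinary_shape S a a' m m' h h'"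
  shows "left_part S = {\<gamma> \<in> S. dinv \<gamma> \<le> a + m}"
    and "mid_part S = {\<gamma> \<in> S. a + m < dinv \<gamma> \<and> dinv \<gamma> < a'}"
    and "right_part S = {\<gamma> \<in> S. a' \<le> dinv \<gamma>}"
proof -
  note A = ordinary_shapeD[OF assms]
  have range: "a \<le> dinv \<gamma> \<and> dinv \<gamma> \<le> a' + m'" if "\<gamma> \<in> S" for \<gamma> using A(4) that by auto
  have ex: "(\<exists>b b' l l' g g'. ordinary_shape S b b' l l' g g' \<and> P b b' l l') \<longleftrightarrow> P a a' m m'" for P
  proof
    assume "\<exists>b b' l l' g g'. ordinary_shape S b b' l l' g g' \<and> P b b' l l'"
    then obtain b b' l l' g g' where "ordinary_shape S b b' l l' g g'" "P b b' l l'" by blast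
    with ordinary_shape_unique[OF assms, of b b' l l' g g'] show "P a a' m m'" by simp
  qed (use assms in blast)
  have l: "(\<exists>a a' m m' h h'. ordinary_shape S a a' m m' h h' \<and> a \<le> dinv \<gamma> \<and> dinv \<gamma> \<le> a + m)
      \<longleftrightarrow> a \<le> dinv \<gamma> \<and> dinv \<gamma> \<le> a + m" for \<gamma> by (rule ex)
  have c: "(\<exists>a a' m m' h h'. ordinary_shape S a a' m m' h h' \<and> a + m < dinv \<gamma> \<and> dinv \<gamma> < a')
      \<longleftrightarrow> a + m < dinv \<gamma> \<and> dinv \<gamma> < a'" for \<gamma> by (rule ex)
  have r: "(\<exists>a a' m m' h h'. ordinary_shape S a a' m m' h h' \<and> a' \<le> dinv \<gamma> \<and> dinv \<gamma> \<le> a' + m')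
      \<longleftrightarrow> a' \<le> dinv \<gamma> \<and> dinv \<gamma> \<le> a' + m'" for \<gamma> by (rule ex)
  note not_tail = ordinary_not_exceptional(1)[OF assms]
    and not_singleton = ordinary_not_exceptional(2)[OF assms]
  show "left_part S = {\<gamma> \<in> S. dinv \<gamma> \<le> a + m}"
    unfolding left_part_def l using range not_tail by blast
  show "mid_part S = {\<gamma> \<in> S. a + m < dinv \<gamma> \<and> dinv \<gamma> < a'}"
    unfolding mid_part_def c using not_tail by blast
  show "right_part S = {\<gamma> \<in> S. a' \<le> dinv \<gamma>}"
    unfolding right_part_def r using range not_singleton by blast
qed

lemma parts_singleton: "left_part {\<gamma>} = {}" "mid_part {\<gamma>} = {}" "right_part {\<gamma>} = {\<gamma>}"
proof -
  have "\<not> ordinary_shape {\<gamma>} a a' m m' h h'" for a a' m m' h h'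
    using ordinary_not_exceptional(2)[of "{\<gamma>}" a a' m m' h h' \<gamma>] by blast
  moreover have "{\<gamma>} \<noteq> tail \<mu>" if "\<mu> \<in> Par" for \<mu>
    using infinite_tail[OF that] by (metis finite.emptyI finite_insert)
  ultimately show "left_part {\<gamma>} = {}" "mid_part {\<gamma>} = {}" "right_part {\<gamma>} = {\<gamma>}"
    by (auto simp: left_part_def mid_part_def right_part_def)
qed

lemma parts_tail:
  assumes "\<mu> \<in> Par"
  shows "left_part (tail \<mu>) = {TI \<mu>}" "mid_part (tail \<mu>) = tail \<mu> - {TI \<mu>}" "right_part (tail \<mu>) = {}"
proof -
  have no: "\<not> ordinary_shape (tail \<mu>) a a' m m' h h'" for a a' m m' h h'
    using ordinary_not_exceptional(1) assms by blast
  have "tail \<mu> \<noteq> {\<gamma>}" for \<gamma>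
    using infinite_tail[OF assms] by (metis finite.emptyI finite_insert)
  then show "right_part (tail \<mu>) = {}" by (simp add: right_part_def no)
  have "(\<exists>\<rho> \<in> Par. tail \<mu> = tail \<rho> \<and> \<gamma> = TI \<rho>) \<longleftrightarrow> \<gamma> = TI \<mu>"
    "(\<exists>\<rho> \<in> Par. tail \<mu> = tail \<rho> \<and> \<gamma> \<noteq> TI \<rho>) \<longleftrightarrow> \<gamma> \<noteq> TI \<mu>" for \<gamma>
    using assms tail_inj[OF assms] by metis+
  then show "left_part (tail \<mu>) = {TI \<mu>}" "mid_part (tail \<mu>) = tail \<mu> - {TI \<mu>}"
    using TI_in_tail[of \<mu>] by (auto simp: left_part_def mid_part_def no)
qed

lemma extremes_ordinary:
  assumes "ordinary_shape S a a' m m' h h'"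
  shows "dinv ` left_part S = {a..a + m}" "dinv ` right_part S = {a'..a' + m'}"
    "dinv ` (left_part S \<union> mid_part S) = {a..<a'}"
    and "low (left_part S) = a" "high (left_part S) = a + m" "height (left_part S) = h"
    and "low (right_part S) = a'" "high (right_part S) = a' + m'" "height (right_part S) = h'"
    and "left_part S \<noteq> {}" "right_part S \<noteq> {}"
proof -
  note A = ordinary_shapeD[OF assms] and P = parts_ordinary[OF assms]
  have img: "dinv ` {\<gamma> \<in> S. Q (dinv \<gamma>)} = {i \<in> {a..a' + m'}. Q i}" for Q
    unfolding A(4)[symmetric] by blast
  show l: "dinv ` left_part S = {a..a + m}" unfolding P img[of "\<lambda>i. i \<le> a + m"] using A(1) by auto
  show r: "dinv ` right_part S = {a'..a' + m'}" unfolding P img[of "\<lambda>i. a' \<le> i"] using A(1) by auto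
  have "left_part S \<union> mid_part S = {\<gamma> \<in> S. dinv \<gamma> < a'}" unfolding P using A(1) by auto
  then show "dinv ` (left_part S \<union> mid_part S) = {a..<a'}"
    using img[of "\<lambda>i. i < a'"] A(1) by auto
  show "low (left_part S) = a" "high (left_part S) = a + m" using low_high_eq[OF l] by simp_all
  show "low (right_part S) = a'" "high (right_part S) = a' + m'" using low_high_eq[OF r] by simp_all
  show ne: "left_part S \<noteq> {}" "right_part S \<noteq> {}" using l r by auto
  show "height (left_part S) = h"
  proof (rule height_eq[OF ne(1)])
    fix \<gamma> assume "\<gamma> \<in> left_part S"
    then have \<gamma>: "\<gamma> \<in> S" "dinv \<gamma> \<le> a + m" unfolding P by auto
    then have "min_Delta \<gamma> = staircase a m h (dinv \<gamma>)" using A(1,5) by simp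
    then show "min_Delta \<gamma> = h"
      using \<gamma> staircase_plateau[of a m h "dinv \<gamma>"] staircase_ge[of h a m "dinv \<gamma>"] by simp
  qed
  show "height (right_part S) = h'"
    by (rule height_eq[OF ne(2)]) (use A(6) P in blast)
qed

lemma extremes_singleton:
  "low (right_part {\<gamma>}) = dinv \<gamma>" "high (right_part {\<gamma>}) = dinv \<gamma>" "height (right_part {\<gamma>}) = min_Delta \<gamma>"
  by (simp_all add: parts_singleton low_def high_def height_def)

lemma extremes_tail:
  assumes "\<mu> \<in> Par"
  shows "low (left_part (tail \<mu>)) = dinv (TI \<mu>)"
    and "high (left_part (tail \<mu>)) = dinv (TI \<mu>)"
    and "height (left_part (tail \<mu>)) = min_Delta (TI \<mu>)"
    and "left_part (tail \<mu>) \<union> mid_part (tail \<mu>) = tail \<mu>"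
  using TI_in_tail[of \<mu>] by (auto simp: parts_tail[OF assms] low_def high_def height_def)

lemma local_chain_cases:
  assumes "local_chain k S"
  obtains (ordinary) a a' m m' h h' where "ordinary_shape S a a' m m' h h'" "\<forall>\<gamma> \<in> S. defc \<gamma> = k"
  | (singleton) \<gamma> where "\<gamma> \<in> Par_of_defc k" "S = {\<gamma>}"
  | (tail) \<mu> where "\<mu> \<in> Par" "sum_list \<mu> = k" "S = tail \<mu>"
  using assms unfolding local_chain_def ordinary_chain_def Par_of_size_def by blast

lemma local_chain_subset: "local_chain k S \<Longrightarrow> S \<subseteq> Par_of_defc k"
proof (elim local_chain_cases)
  fix a a' m m' h h' assume "ordinary_shape S a a' m m' h h'" "\<forall>\<gamma> \<in> S. defc \<gamma> = k"
  then show ?thesis using ordinary_shapeD(2) by (fastforce simp: Par_of_defc_def)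
next
  fix \<mu> assume "\<mu> \<in> Par" "sum_list \<mu> = k" "S = tail \<mu>"
  then show ?thesis using tail_properties(1,3)[of \<mu>] by (auto simp: Par_of_defc_def tail_def)
qed auto

lemma local_chain_inj: "local_chain k S \<Longrightarrow> inj_on dinv S"
  by (erule local_chain_cases) (auto simp: ordinary_shapeD(3) inj_on_dinv_tail)

lemma local_chain_parts:
  assumes "local_chain k S"
  shows "S = left_part S \<union> mid_part S \<union> right_part S"
    and "(left_part S \<union> mid_part S) \<inter> right_part S = {}" and "left_part S \<inter> mid_part S = {}"
proof -
  have "S = left_part S \<union> mid_part S \<union> right_part S
    \<and> (left_part S \<union> mid_part S) \<inter> right_part S = {} \<and> left_part S \<inter> mid_part S = {}"
    using assms
  proof (cases rule: local_chain_cases)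
    case ordinary
    show ?thesis unfolding parts_ordinary[OF ordinary(1)]
      using ordinary_shapeD(1)[OF ordinary(1)] by auto
  next
    case (singleton \<gamma>)
    then show ?thesis by (simp add: parts_singleton)
  next
    case (tail \<mu>)
    then show ?thesis using TI_in_tail[of \<mu>] by (auto simp: parts_tail)
  qed
  then show "S = left_part S \<union> mid_part S \<union> right_part S"
    "(left_part S \<union> mid_part S) \<inter> right_part S = {}" "left_part S \<inter> mid_part S = {}" by blast+
qed

lemma local_chain_left_empty:
  assumes "local_chain k S" "left_part S = {}"
  obtains \<gamma> where "S = {\<gamma>}"
  using assms(1)
  by (cases rule: local_chain_cases) (use assms(2) extremes_ordinary(10) parts_tail that in auto)

lemma local_chain_right_empty:
  assumes "local_chain k S" "right_part S = {}"
  obtains \<mu> where "\<mu> \<in> Par" "sum_list \<mu> = k" "S = tail \<mu>"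
  using assms(1)
  by (cases rule: local_chain_cases) (use assms(2) extremes_ordinary(11) parts_singleton that in auto)

lemma local_chain_dinv:
  assumes "local_chain k S" "left_part S \<noteq> {}" "right_part S \<noteq> {}"
  shows "low (left_part S) < low (right_part S)
    \<and> dinv ` (left_part S \<union> mid_part S) = {low (left_part S)..<low (right_part S)}"
  using assms(1)
proof (cases rule: local_chain_cases)
  case ordinary
  show ?thesis
    unfolding extremes_ordinary[OF ordinary(1)] using ordinary_shapeD(1)[OF ordinary(1)] by simp
qed (use assms parts_singleton parts_tail in auto)

lemma local_chain_dinv_tail:
  assumes "local_chain k S" "right_part S = {}"
  shows "dinv ` (left_part S \<union> mid_part S) = {low (left_part S)..}"
  using local_chain_right_empty[OF assms] by (metis extremes_tail(1,4) dinv_tail)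

text \<open>The last member of the body of an ordinary chain is strictly higher than its right part.\<close>

lemma local_chain_descent:
  assumes "local_chain k S" "left_part S \<noteq> {}" "right_part S \<noteq> {}"
  obtains \<delta> where "\<delta> \<in> left_part S \<union> mid_part S" "Suc (dinv \<delta>) = low (right_part S)"
    "height (right_part S) < min_Delta \<delta>"
  using assms(1)
proof (cases rule: local_chain_cases)
  case (ordinary a a' m m' h h')
  note E = extremes_ordinary[OF ordinary(1)] and A = ordinary_shapeD[OF ordinary(1)]
  have "a' - 1 \<in> dinv ` (left_part S \<union> mid_part S)" unfolding E using A(1) by auto
  then obtain \<delta> where \<delta>: "\<delta> \<in> left_part S \<union> mid_part S" "dinv \<delta> = a' - 1"
    by (metis imageE)
  then have "\<delta> \<in> S" using local_chain_parts(1)[OF assms(1)] by blast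
  with \<delta> A(1) have "Suc (dinv \<delta>) = low (right_part S)" "height (right_part S) < min_Delta \<delta>"
    using A(7)[of \<delta>] unfolding E by auto
  with \<delta>(1) show ?thesis by (rule that)
next
  case (singleton \<gamma>)
  with assms(2) show ?thesis by (simp add: parts_singleton)
next
  case (tail \<mu>)
  with assms(3) show ?thesis by (simp add: parts_tail)
qed

text \<open>For ordinary chains this is part of the definition. For a singleton opposite to \<open>tail(\<mu>)\<close>
  it is the value of \<open>dinv (TI \<mu>)\<close>.\<close>

lemma opposite_of_right:
  assumes "locally_opposite k S T" "right_part S \<noteq> {}"
  shows "left_part T \<noteq> {} \<and> height (left_part T) = height (right_part S)
    \<and> high (right_part S) + k + low (left_part T) = height (right_part S) choose 2"
  using assms(1) unfolding locally_opposite_def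
proof
  assume "ordinary_opposite k S T"
  then obtain a\<^sub>S a'\<^sub>S m\<^sub>S m'\<^sub>S h\<^sub>S h'\<^sub>S a\<^sub>T a'\<^sub>T m\<^sub>T m'\<^sub>T h\<^sub>T h'\<^sub>T where
    S: "ordinary_shape S a\<^sub>S a'\<^sub>S m\<^sub>S m'\<^sub>S h\<^sub>S h'\<^sub>S" and T: "ordinary_shape T a\<^sub>T a'\<^sub>T m\<^sub>T m'\<^sub>T h\<^sub>T h'\<^sub>T"
    and "h\<^sub>T = h'\<^sub>S" "a'\<^sub>S + m'\<^sub>S + k + a\<^sub>T = h'\<^sub>S choose 2"
    unfolding ordinary_opposite_def by blast
  then show ?thesis using extremes_ordinary(10)[OF T]
    unfolding extremes_ordinary(4,6)[OF T] extremes_ordinary(8,9)[OF S] by blast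
next
  assume "exceptional_opposite k S T"
  then obtain \<mu> \<gamma> where \<mu>: "\<mu> \<in> Par" "sum_list \<mu> = k"
    and ST: "S = tail \<mu> \<and> T = {\<gamma>} \<or> S = {\<gamma>} \<and> T = tail \<mu>"
    and eq: "dinv \<gamma> = length \<mu>" "min_Delta \<gamma> = min_Delta (TI \<mu>)"
    unfolding exceptional_opposite_def Par_of_size_def by blast
  from ST assms(2) parts_tail(3)[OF \<mu>(1)] have "S = {\<gamma>}" "T = tail \<mu>" by auto
  moreover have "length \<mu> + k + dinv (TI \<mu>) = min_Delta (TI \<mu>) choose 2"
    using dinv_TI[OF \<mu>(1)] \<mu>(2) by (simp add: min_Delta_TI[OF \<mu>(1)])
  ultimately show ?thesis
    using eq by (simp add: parts_singleton parts_tail[OF \<mu>(1)] low_def high_def height_def)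
qed

text \<open>The position at which a staircase passes the height \<open>n\<close> is expressed by the right part of the
  opposite chain, because opposition ties the end of the plateau of one to the start of the right
  part of the other.\<close>

lemma opposite_of_left:
  assumes "locally_opposite k S T" "left_part S \<noteq> {}"
  shows "right_part T \<noteq> {}"
    and "high (left_part S) + k + low (right_part T) = height (left_part S) choose 2"
    and "\<gamma> \<in> left_part S \<union> mid_part S \<Longrightarrow> min_Delta \<gamma> \<le> n \<longleftrightarrow>
      height (left_part S) \<le> n \<and> dinv \<gamma> + k + low (right_part T) \<le> n choose 2"
  using assms(1) unfolding locally_opposite_def
proof (atomize (full), elim disjE)
  assume "ordinary_opposite k S T"
  then obtain a\<^sub>S a'\<^sub>S m\<^sub>S m'\<^sub>S h\<^sub>S h'\<^sub>S a\<^sub>T a'\<^sub>T m\<^sub>T m'\<^sub>T h\<^sub>T h'\<^sub>T where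
    S: "ordinary_shape S a\<^sub>S a'\<^sub>S m\<^sub>S m'\<^sub>S h\<^sub>S h'\<^sub>S" and T: "ordinary_shape T a\<^sub>T a'\<^sub>T m\<^sub>T m'\<^sub>T h\<^sub>T h'\<^sub>T"
    and eq: "a\<^sub>S + m\<^sub>S + k + a'\<^sub>T = h\<^sub>S choose 2"
    unfolding ordinary_opposite_def by blast
  have "min_Delta \<gamma> \<le> n \<longleftrightarrow> h\<^sub>S \<le> n \<and> dinv \<gamma> + k + a'\<^sub>T \<le> n choose 2"
    if "\<gamma> \<in> left_part S \<union> mid_part S"
  proof -
    have "\<gamma> \<in> S" "dinv \<gamma> < a'\<^sub>S"
      using that ordinary_shapeD(1)[OF S] unfolding parts_ordinary[OF S] by auto
    then have "min_Delta \<gamma> = staircase a\<^sub>S m\<^sub>S h\<^sub>S (dinv \<gamma>)" by (rule ordinary_shapeD(5)[OF S])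
    then show ?thesis using staircase_le_iff[of a\<^sub>S m\<^sub>S h\<^sub>S "dinv \<gamma>" n] eq by auto
  qed
  then show "right_part T \<noteq> {}
    \<and> high (left_part S) + k + low (right_part T) = height (left_part S) choose 2
    \<and> (\<gamma> \<in> left_part S \<union> mid_part S \<longrightarrow> (min_Delta \<gamma> \<le> n \<longleftrightarrow>
      height (left_part S) \<le> n \<and> dinv \<gamma> + k + low (right_part T) \<le> n choose 2))"
    using extremes_ordinary(11)[OF T] eq
    unfolding extremes_ordinary(7)[OF T] extremes_ordinary(5,6)[OF S] by blast
next
  assume "exceptional_opposite k S T"
  then obtain \<mu> \<delta> where \<mu>: "\<mu> \<in> Par" "sum_list \<mu> = k"
    and ST: "S = tail \<mu> \<and> T = {\<delta>} \<or> S = {\<delta>} \<and> T = tail \<mu>" and eq: "dinv \<delta> = length \<mu>"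
    unfolding exceptional_opposite_def Par_of_size_def by blast
  from ST assms(2) parts_singleton(1)[of \<delta>] have ST: "S = tail \<mu>" "T = {\<delta>}" by auto
  have "min_Delta \<gamma> \<le> n \<longleftrightarrow> min_Delta (TI \<mu>) \<le> n \<and> dinv \<gamma> + k + length \<mu> \<le> n choose 2"
    if "\<gamma> \<in> tail \<mu>" using that tail_properties(4)[OF \<mu>(1)] \<mu>(2) by (auto simp: tail_def)
  then show "right_part T \<noteq> {}
    \<and> high (left_part S) + k + low (right_part T) = height (left_part S) choose 2
    \<and> (\<gamma> \<in> left_part S \<union> mid_part S \<longrightarrow> (min_Delta \<gamma> \<le> n \<longleftrightarrow>
      height (left_part S) \<le> n \<and> dinv \<gamma> + k + low (right_part T) \<le> n choose 2))"
    using dinv_TI[OF \<mu>(1)] \<mu>(2)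
    unfolding ST extremes_tail[OF \<mu>(1)] extremes_singleton eq min_Delta_TI[OF \<mu>(1), symmetric]
    by (simp add: parts_singleton)
qed

lemma opposite_of_singleton:
  assumes "locally_opposite k S T" "left_part S = {}"
  obtains \<mu> where "\<mu> \<in> Par_of_size k" "T = tail \<mu>" "low (right_part S) = length \<mu>"
proof -
  have "\<not> ordinary_opposite k S T"
    using assms(2) extremes_ordinary(10) unfolding ordinary_opposite_def by blast
  with assms(1) have "exceptional_opposite k S T" by (simp add: locally_opposite_def)
  then obtain \<mu> \<gamma> where \<mu>: "\<mu> \<in> Par_of_size k"
    and ST: "S = tail \<mu> \<and> T = {\<gamma>} \<or> S = {\<gamma>} \<and> T = tail \<mu>" and eq: "dinv \<gamma> = length \<mu>"
    unfolding exceptional_opposite_def by blast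
  from ST assms(2) parts_tail(1)[of \<mu>] \<mu> have "S = {\<gamma>}" "T = tail \<mu>"
    by (auto simp: Par_of_size_def)
  with \<mu> eq show ?thesis by (intro that) (simp_all add: extremes_singleton)
qed

section \<open>The graph of chains\<close>

text \<open>The members of a chain that do not also belong to its successor.\<close>

definition body :: "nat list set \<Rightarrow> nat list set" where
  "body S = left_part S \<union> mid_part S"

lemma nu_segment_closed:
  assumes "\<delta> \<in> nu_segment \<gamma>" "\<delta> \<in> Par" "nu_defined \<delta>"
  shows "nu \<delta> \<in> nu_segment \<gamma>"
proof -
  have step: "nu_step \<delta> (nu \<delta>)" using assms by (simp add: nu_step_def)
  from assms(1) obtain m where "(nu_step ^^ m) \<gamma> \<delta> \<or> (nu_step ^^ m) \<delta> \<gamma>"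
    unfolding nu_segment_def by blast
  then have "\<exists>m. (nu_step ^^ m) \<gamma> (nu \<delta>) \<or> (nu_step ^^ m) (nu \<delta>) \<gamma>"
  proof
    assume "(nu_step ^^ m) \<gamma> \<delta>"
    then have "(nu_step ^^ Suc m) \<gamma> (nu \<delta>)" using step by (rule relpowp_Suc_I)
    then show ?thesis by blast
  next
    assume *: "(nu_step ^^ m) \<delta> \<gamma>"
    show ?thesis
    proof (cases m)
      case 0
      with * have "\<delta> = \<gamma>" by simp
      moreover have "(nu_step ^^ 1) \<delta> (nu \<delta>)" using step unfolding relpowp_1 .
      ultimately have "(nu_step ^^ 1) \<gamma> (nu \<delta>)" by simp
      then show ?thesis by blast
    next
      case (Suc m')
      with * obtain \<epsilon> where "nu_step \<delta> \<epsilon>" "(nu_step ^^ m') \<epsilon> \<gamma>" using relpowp_Suc_D2 by metis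
      then have "(nu_step ^^ m') (nu \<delta>) \<gamma>" by (simp add: nu_step_def)
      then show ?thesis by blast
    qed
  qed
  then show ?thesis by (simp add: nu_segment_def)
qed

text \<open>The hypotheses of the theorem for one value of the deficit.\<close>

locale chain_system =
  fixes k :: nat and L :: "nat list set set" and opp :: "nat list set \<Rightarrow> nat list set"
  assumes chain: "S \<in> L \<Longrightarrow> local_chain k S"
    and opp_in: "S \<in> L \<Longrightarrow> opp S \<in> L" and opp_opp: "S \<in> L \<Longrightarrow> opp (opp S) = S"
    and tail_in: "\<mu> \<in> Par_of_size k \<Longrightarrow> tail \<mu> \<in> L"
    and meet: "S \<in> L \<Longrightarrow> T \<in> L \<Longrightarrow> S \<noteq> T \<Longrightarrow>
      S \<inter> T = {} \<or> right_part S = left_part T \<or> right_part T = left_part S"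
    and cover: "\<gamma> \<in> Par_of_defc k \<Longrightarrow>
      (\<exists>S. {X \<in> L. \<gamma> \<in> X} = {S} \<and> \<gamma> \<in> mid_part S) \<or>
      (\<exists>S T. S \<noteq> T \<and> {X \<in> L. \<gamma> \<in> X} = {S, T} \<and> \<gamma> \<in> right_part S \<and> \<gamma> \<in> left_part T)"
    and opposite: "S \<in> L \<Longrightarrow> locally_opposite k S (opp S)"
    and opp_meet: "S \<in> L \<Longrightarrow> T \<in> L \<Longrightarrow> S \<inter> T \<noteq> {} \<Longrightarrow> opp S \<inter> opp T \<noteq> {}"
    and segments: "S \<in> L \<Longrightarrow> \<exists>G \<subseteq> Par. left_part S \<union> mid_part S = (\<Union>\<gamma> \<in> G. nu_segment \<gamma>)"
begin

lemma body_right_decomposition: "S \<in> L \<Longrightarrow> S = body S \<union> right_part S" "S \<in> L \<Longrightarrow> body S \<inter> right_part S = {}"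
  unfolding body_def by (fact local_chain_parts(1,2)[OF chain])+

lemma left_subset_body: "left_part S \<subseteq> body S"
  by (simp add: body_def)

lemma body_subset: "S \<in> L \<Longrightarrow> body S \<subseteq> S"
  using body_right_decomposition(1) by blast

lemma body_dinv_ge:
  assumes "S \<in> L" "\<gamma> \<in> body S"
  shows "left_part S \<noteq> {}" "low (left_part S) \<le> dinv \<gamma>"
proof -
  show ne: "left_part S \<noteq> {}"
  proof
    assume "left_part S = {}"
    with chain[OF assms(1)] obtain \<delta> where "S = {\<delta>}" by (rule local_chain_left_empty)
    with assms(2) show False by (simp add: body_def parts_singleton)
  qed
  have "dinv \<gamma> \<in> dinv ` (left_part S \<union> mid_part S)" using assms(2) by (auto simp: body_def)
  then show "low (left_part S) \<le> dinv \<gamma>"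
    using local_chain_dinv[OF chain[OF assms(1)] ne] local_chain_dinv_tail[OF chain[OF assms(1)]]
    by (cases "right_part S = {}") auto
qed

lemma body_dinv_less:
  assumes "S \<in> L" "\<gamma> \<in> body S" "right_part S \<noteq> {}"
  shows "dinv \<gamma> < low (right_part S)"
proof -
  have "dinv \<gamma> \<in> dinv ` (left_part S \<union> mid_part S)" using assms(2) by (auto simp: body_def)
  then show ?thesis
    using local_chain_dinv[OF chain[OF assms(1)] body_dinv_ge(1)[OF assms(1,2)] assms(3)] by auto
qed

text \<open>A partition is interior to one chain or shared by two consecutive ones.\<close>

lemma member_cases:
  assumes "\<gamma> \<in> Par_of_defc k"
  obtains (inner) S where "S \<in> L" "\<gamma> \<in> mid_part S" "\<And>X. X \<in> L \<Longrightarrow> \<gamma> \<in> X \<Longrightarrow> X = S"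
  | (boundary) A B where "A \<in> L" "B \<in> L" "\<gamma> \<in> right_part A" "\<gamma> \<in> left_part B"
      "\<And>X. X \<in> L \<Longrightarrow> \<gamma> \<in> X \<Longrightarrow> X = A \<or> X = B"
  using cover[OF assms]
proof (elim disjE exE conjE)
  fix S assume *: "{X \<in> L. \<gamma> \<in> X} = {S}" "\<gamma> \<in> mid_part S"
  have "X \<in> L \<and> \<gamma> \<in> X \<longleftrightarrow> X = S" for X using *(1) by (simp add: set_eq_iff)
  then have "S \<in> L" "\<And>X. X \<in> L \<Longrightarrow> \<gamma> \<in> X \<Longrightarrow> X = S" by blast+
  with *(2) show thesis using inner by blast
next
  fix A B assume *: "{X \<in> L. \<gamma> \<in> X} = {A, B}" "\<gamma> \<in> right_part A" "\<gamma> \<in> left_part B"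
  have "X \<in> L \<and> \<gamma> \<in> X \<longleftrightarrow> X = A \<or> X = B" for X using *(1) by (simp add: set_eq_iff)
  then have "A \<in> L" "B \<in> L" "\<And>X. X \<in> L \<Longrightarrow> \<gamma> \<in> X \<Longrightarrow> X = A \<or> X = B" by blast+
  with *(2,3) show thesis using boundary by blast
qed

lemma body_unique:
  assumes "S \<in> L" "T \<in> L" "\<gamma> \<in> body S" "\<gamma> \<in> body T"
  shows "S = T"
proof -
  have mem: "\<gamma> \<in> S" "\<gamma> \<in> T" using assms body_subset by blast+
  then have "\<gamma> \<in> Par_of_defc k" using local_chain_subset[OF chain[OF assms(1)]] by blast
  then show ?thesis
  proof (cases rule: member_cases)
    case (inner A)
    show ?thesis using inner(3)[OF assms(1) mem(1)] inner(3)[OF assms(2) mem(2)] by simp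
  next
    case (boundary A B)
    have "S \<noteq> A" "T \<noteq> A"
      using assms(3,4) boundary(3) body_right_decomposition(2)[OF boundary(1)] by blast+
    then show ?thesis using boundary(5)[OF assms(1) mem(1)] boundary(5)[OF assms(2) mem(2)] by simp
  qed
qed

lemma body_exists:
  assumes "\<gamma> \<in> Par_of_defc k"
  obtains S where "S \<in> L" "\<gamma> \<in> body S"
  using assms
proof (cases rule: member_cases)
  case (inner S)
  then show thesis using that[of S] by (simp add: body_def)
next
  case (boundary A B)
  then show thesis using that[of B] by (simp add: body_def)
qed

text \<open>One common member suffices as definition; \<open>link_eq\<close> below shows that then the two parts agree.\<close>

definition links :: "(nat list set \<times> nat list set) set" where
  "links = {(S, T). S \<in> L \<and> T \<in> L \<and> right_part S \<inter> left_part T \<noteq> {}}"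

lemma linksI: "S \<in> L \<Longrightarrow> T \<in> L \<Longrightarrow> \<gamma> \<in> right_part S \<Longrightarrow> \<gamma> \<in> left_part T \<Longrightarrow> (S, T) \<in> links"
  unfolding links_def by blast

lemma common_member:
  assumes "S \<in> L" "T \<in> L" "S \<noteq> T" "S \<inter> T \<noteq> {}"
  shows "(S, T) \<in> links \<or> (T, S) \<in> links"
proof -
  from assms(4) obtain \<gamma> where \<gamma>: "\<gamma> \<in> S" "\<gamma> \<in> T" by blast
  then have "\<gamma> \<in> Par_of_defc k" using local_chain_subset[OF chain[OF assms(1)]] by blast
  then show ?thesis
  proof (cases rule: member_cases)
    case (inner A)
    show ?thesis using inner(3)[OF assms(1) \<gamma>(1)] inner(3)[OF assms(2) \<gamma>(2)] assms(3) by simp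
  next
    case (boundary A B)
    have "(A, B) \<in> links" by (rule linksI[OF boundary(1-4)])
    moreover have "S = A \<and> T = B \<or> S = B \<and> T = A"
      using boundary(5)[OF assms(1) \<gamma>(1)] boundary(5)[OF assms(2) \<gamma>(2)] assms(3) by auto
    ultimately show ?thesis by blast
  qed
qed

lemma successor_exists:
  assumes "S \<in> L" "right_part S \<noteq> {}"
  obtains T where "(S, T) \<in> links"
proof -
  from assms(2) obtain \<gamma> where \<gamma>: "\<gamma> \<in> right_part S" by blast
  then have mem: "\<gamma> \<in> S" using body_right_decomposition(1)[OF assms(1)] by blast
  then have "\<gamma> \<in> Par_of_defc k" using local_chain_subset[OF chain[OF assms(1)]] by blast
  then show thesis
  proof (cases rule: member_cases)
    case (inner A)
    have "\<gamma> \<in> body S" using inner(2) inner(3)[OF assms(1) mem] by (simp add: body_def)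
    then show thesis using \<gamma> body_right_decomposition(2)[OF assms(1)] by blast
  next
    case (boundary A B)
    show thesis using linksI[OF assms(1) boundary(2) \<gamma> boundary(4)] by (rule that)
  qed
qed

lemma predecessor_exists:
  assumes "T \<in> L" "left_part T \<noteq> {}"
  obtains S where "(S, T) \<in> links"
proof -
  from assms(2) obtain \<gamma> where \<gamma>: "\<gamma> \<in> left_part T" by blast
  then have mem: "\<gamma> \<in> T" using left_subset_body body_subset[OF assms(1)] by blast
  then have "\<gamma> \<in> Par_of_defc k" using local_chain_subset[OF chain[OF assms(1)]] by blast
  then show thesis
  proof (cases rule: member_cases)
    case (inner A)
    have "\<gamma> \<in> mid_part T" using inner(2) inner(3)[OF assms(1) mem] by simp
    then show thesis using \<gamma> local_chain_parts(3)[OF chain[OF assms(1)]] by blast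
  next
    case (boundary A B)
    show thesis using linksI[OF boundary(1) assms(1) boundary(3) \<gamma>] by (rule that)
  qed
qed

lemma links_in: "(S, T) \<in> links \<Longrightarrow> S \<in> L" "(S, T) \<in> links \<Longrightarrow> T \<in> L"
  unfolding links_def by blast+

lemma links_nonempty: "(S, T) \<in> links \<Longrightarrow> right_part S \<noteq> {}" "(S, T) \<in> links \<Longrightarrow> left_part T \<noteq> {}"
  unfolding links_def by blast+

lemma links_neq: "(S, T) \<in> links \<Longrightarrow> S \<noteq> T"
  using body_right_decomposition(2)[of S] left_subset_body[of S] unfolding links_def by blast

text \<open>If instead the right part of \<open>T\<close> were the left part of \<open>S\<close>, then the values of \<open>dinv\<close> would
  increase from the left to the right part of \<open>S\<close> and from there, through \<open>T\<close>, back to the left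
  part of \<open>S\<close>. The exception is a singleton and a tail, where this common part is empty and a
  member shared by the other two parts is all they consist of.\<close>

lemma link_eq:
  assumes "(S, T) \<in> links"
  shows "right_part S = left_part T"
proof -
  have S: "S \<in> L" and T: "T \<in> L" using links_in[OF assms] .
  from assms obtain \<gamma> where \<gamma>: "\<gamma> \<in> right_part S" "\<gamma> \<in> left_part T" by (auto simp: links_def)
  then have "\<gamma> \<in> S \<inter> T" using S T body_right_decomposition(1) left_subset_body body_subset by blast
  with meet[OF S T links_neq[OF assms]]
  consider "right_part S = left_part T" | "right_part T = left_part S" by blast
  then show ?thesis
  proof cases
    case 2
    show ?thesis
    proof (cases "left_part S = {}")
      case True
      obtain \<delta> where "S = {\<delta>}" using chain[OF S] True by (rule local_chain_left_empty)
      then have r: "right_part S = {\<gamma>}" using \<gamma>(1) by (simp add: parts_singleton)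
      obtain \<mu> where "\<mu> \<in> Par" "T = tail \<mu>"
        using local_chain_right_empty[OF chain[OF T]] 2 True by metis
      then show ?thesis using r \<gamma>(2) by (simp add: parts_tail)
    next
      case False
      have "low (left_part S) < low (right_part S)"
        using local_chain_dinv[OF chain[OF S] False] \<gamma>(1) by blast
      moreover have "low (right_part S) \<le> dinv \<gamma>" using \<gamma>(1) by (rule low_le)
      moreover have "dinv \<gamma> < low (right_part T)"
        using body_dinv_less[OF T] \<gamma>(2) left_subset_body False 2 by blast
      ultimately show ?thesis using 2 by simp
    qed
  qed
qed

lemma single_valued_links: "single_valued links"
proof (rule single_valuedI)
  fix S T T' assume *: "(S, T) \<in> links" "(S, T') \<in> links"
  then have "left_part T = left_part T'" using link_eq[OF *(1)] link_eq[OF *(2)] by simp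
  moreover obtain \<gamma> where "\<gamma> \<in> left_part T" using links_nonempty(2)[OF *(1)] by blast
  ultimately have "\<gamma> \<in> body T" "\<gamma> \<in> body T'" by (simp_all add: body_def)
  then show "T = T'" by (rule body_unique[OF links_in(2)[OF *(1)] links_in(2)[OF *(2)]])
qed

text \<open>The opposite chains share a member, so they are linked one way or the other. The equations for
  opposite chains force the left part of \<open>opp S\<close> to begin at the same value of \<open>dinv\<close> as the right
  part of \<open>opp T\<close>. A link from \<open>opp S\<close> to \<open>opp T\<close> would put it strictly before.\<close>

lemma link_opp:
  assumes "(S, T) \<in> links"
  shows "(opp T, opp S) \<in> links"
proof -
  have S: "S \<in> L" and T: "T \<in> L" using links_in[OF assms] .
  note ne = links_nonempty[OF assms]
  have eq: "right_part S = left_part T" by (rule link_eq[OF assms])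
  have "S \<inter> T \<noteq> {}" using eq ne S T body_right_decomposition(1) left_subset_body body_subset by blast
  then have "opp S \<inter> opp T \<noteq> {}" by (rule opp_meet[OF S T])
  moreover have "opp S \<noteq> opp T" using links_neq[OF assms] opp_opp S T by metis
  ultimately consider "(opp T, opp S) \<in> links" | "(opp S, opp T) \<in> links"
    using common_member[OF opp_in[OF S] opp_in[OF T]] by blast
  then show ?thesis
  proof cases
    case 2
    have l: "left_part (opp S) \<noteq> {}"
      "high (right_part S) + k + low (left_part (opp S)) = height (right_part S) choose 2"
      using opposite_of_right[OF opposite[OF S] ne(1)] by blast+
    have r: "right_part (opp T) \<noteq> {}"
      "high (left_part T) + k + low (right_part (opp T)) = height (left_part T) choose 2"
      using opposite_of_left(1,2)[OF opposite[OF T] ne(2)] by blast+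
    have "low (left_part (opp S)) < low (right_part (opp S))"
      using local_chain_dinv[OF chain[OF opp_in[OF S]] l(1)] links_nonempty(1)[OF 2] by blast
    also have "\<dots> = low (left_part (opp T))" using link_eq[OF 2] by simp
    also have "\<dots> < low (right_part (opp T))"
      using local_chain_dinv[OF chain[OF opp_in[OF T]] links_nonempty(2)[OF 2] r(1)] by blast
    also have "\<dots> = low (left_part (opp S))" using l(2) r(2) eq by simp
    finally show ?thesis by simp
  qed
qed

lemma path_opp: "(S, T) \<in> links\<^sup>* \<Longrightarrow> (opp T, opp S) \<in> links\<^sup>*"
proof (induction rule: rtrancl_induct)
  case (step U T)
  from link_opp[OF step.hyps(2)] step.IH show ?case by (rule converse_rtrancl_into_rtrancl)
qed simp

lemma path_in: "(S, T) \<in> links\<^sup>* \<Longrightarrow> S \<in> L \<longleftrightarrow> T \<in> L"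
proof (induction rule: rtrancl_induct)
  case (step T U)
  then show ?case using links_in[OF step.hyps(2)] by blast
qed simp

text \<open>Walking backwards lowers the least \<open>dinv\<close> of the left part; the measure ranks chains with an
  empty left part below all others.\<close>

lemma origin_exists:
  assumes "S \<in> L"
  shows "\<exists>R. R \<in> L \<and> left_part R = {} \<and> (R, S) \<in> links\<^sup>*"
  using assms
proof (induction "if left_part S = {} then 0 else Suc (low (left_part S))" arbitrary: S rule: less_induct)
  case less
  show ?case
  proof (cases "left_part S = {}")
    case True
    with less.prems show ?thesis by blast
  next
    case False
    obtain R where R: "(R, S) \<in> links" using predecessor_exists[OF less.prems False] .
    have RL: "R \<in> L" using links_in(1)[OF R] .
    have "low (left_part R) < low (left_part S)" if "left_part R \<noteq> {}"
      using local_chain_dinv[OF chain[OF RL] that links_nonempty(1)[OF R]] link_eq[OF R] by simp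
    then have "(if left_part R = {} then 0 else Suc (low (left_part R)))
        < (if left_part S = {} then 0 else Suc (low (left_part S)))" using False by simp
    from less.hyps[OF this RL] R show ?thesis by (blast intro: rtrancl_into_rtrancl)
  qed
qed

lemma opp_tail:
  assumes "\<mu> \<in> Par_of_size k"
  shows "left_part (opp (tail \<mu>)) = {}" "low (right_part (opp (tail \<mu>))) = length \<mu>"
    "right_part (opp (tail \<mu>)) \<noteq> {}"
proof -
  have \<mu>: "\<mu> \<in> Par" using assms by (simp add: Par_of_size_def)
  have L: "tail \<mu> \<in> L" by (rule tail_in[OF assms])
  note opp1 = opposite[OF L] and opp2 = opposite[OF opp_in[OF L], unfolded opp_opp[OF L]]
  show r: "right_part (opp (tail \<mu>)) \<noteq> {}"
    using opposite_of_left(1)[OF opp1] by (simp add: parts_tail[OF \<mu>])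
  show l: "left_part (opp (tail \<mu>)) = {}"
    using opposite_of_left(1)[OF opp2] parts_tail(3)[OF \<mu>] by blast
  obtain \<rho> where \<rho>: "\<rho> \<in> Par_of_size k" "tail \<mu> = tail \<rho>" "low (right_part (opp (tail \<mu>))) = length \<rho>"
    using opposite_of_singleton[OF opp2 l] .
  then have "\<rho> = \<mu>" using tail_inj \<mu> unfolding Par_of_size_def by blast
  with \<rho> show "low (right_part (opp (tail \<mu>))) = length \<mu>" by simp
qed

lemma origin_is_opp_tail:
  assumes "R \<in> L" "left_part R = {}"
  obtains \<rho> where "\<rho> \<in> Par_of_size k" "R = opp (tail \<rho>)"
  using opposite_of_singleton[OF opposite[OF assms(1)] assms(2)] opp_opp[OF assms(1)] by metis

text \<open>The opposite chain has an origin, and the opposite of a path is a path in the other direction.\<close>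

lemma terminus_exists:
  assumes "S \<in> L"
  obtains \<mu> where "\<mu> \<in> Par_of_size k" "(S, tail \<mu>) \<in> links\<^sup>*"
proof -
  obtain R where R: "R \<in> L" "left_part R = {}" "(R, opp S) \<in> links\<^sup>*"
    using origin_exists[OF opp_in[OF assms]] by blast
  obtain \<rho> where \<rho>: "\<rho> \<in> Par_of_size k" "R = opp (tail \<rho>)"
    using origin_is_opp_tail[OF R(1,2)] .
  have "(S, tail \<rho>) \<in> links\<^sup>*"
    using path_opp[OF R(3)] by (simp add: \<rho>(2) opp_opp assms tail_in[OF \<rho>(1)])
  with \<rho>(1) show thesis by (rule that)
qed

lemma tail_terminal:
  assumes "\<mu> \<in> Par_of_size k" "(tail \<mu>, T) \<in> links\<^sup>*"
  shows "T = tail \<mu>"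
  using assms(2)
proof (cases rule: converse_rtranclE)
  case (step U)
  then show ?thesis
    using links_nonempty(1)[OF step(1)] parts_tail(3)[of \<mu>] assms(1) by (simp add: Par_of_size_def)
qed simp

lemma terminus_unique:
  assumes "\<mu> \<in> Par_of_size k" "\<rho> \<in> Par_of_size k"
    "(S, tail \<mu>) \<in> links\<^sup>*" "(S, tail \<rho>) \<in> links\<^sup>*"
  shows "\<mu> = \<rho>"
proof -
  have "tail \<mu> = tail \<rho>"
    using single_valued_confluent[OF single_valued_links assms(3,4)]
      tail_terminal[OF assms(1)] tail_terminal[OF assms(2)] by metis
  then show ?thesis using tail_inj assms(1,2) by (simp add: Par_of_size_def)
qed

definition upset :: "nat list set \<Rightarrow> nat list set" where
  "upset S = (\<Union>T \<in> links\<^sup>* `` {S}. body T)"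

lemma upset_step:
  assumes "(S, T) \<in> links"
  shows "upset S = body S \<union> upset T"
proof -
  have "(S, U) \<in> links\<^sup>* \<longleftrightarrow> U = S \<or> (T, U) \<in> links\<^sup>*" for U
  proof
    assume "(S, U) \<in> links\<^sup>*"
    then show "U = S \<or> (T, U) \<in> links\<^sup>*"
      by (cases rule: converse_rtranclE) (use single_valuedD[OF single_valued_links assms] in auto)
  qed (use assms in \<open>auto intro: converse_rtrancl_into_rtrancl\<close>)
  then show ?thesis by (auto simp: upset_def)
qed

text \<open>The intervals of values of \<open>dinv\<close> on the bodies along the path abut, and the last one is
  unbounded.\<close>

lemma dinv_upset:
  assumes "(S, tail \<mu>) \<in> links\<^sup>*" "\<mu> \<in> Par_of_size k" "left_part S \<noteq> {}"
  shows "inj_on dinv (upset S) \<and> dinv ` upset S = {low (left_part S)..}"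
  using assms(1,3)
proof (induction rule: converse_rtrancl_induct)
  case base
  have \<mu>: "\<mu> \<in> Par" using assms(2) by (simp add: Par_of_size_def)
  have "links\<^sup>* `` {tail \<mu>} = {tail \<mu>}" using tail_terminal[OF assms(2)] by auto
  then have "upset (tail \<mu>) = tail \<mu>"
    by (simp add: upset_def body_def extremes_tail(4)[OF \<mu>])
  then show ?case
    using inj_on_dinv_tail[OF \<mu>] dinv_tail[OF \<mu>] by (simp add: extremes_tail(1)[OF \<mu>])
next
  case (step S T)
  have S: "S \<in> L" using links_in(1)[OF step.hyps(1)] .
  note ne = links_nonempty[OF step.hyps(1)]
  have IH: "inj_on dinv (upset T)" "dinv ` upset T = {low (right_part S)..}"
    using step.IH[OF ne(2)] link_eq[OF step.hyps(1)] by simp_all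
  have b: "low (left_part S) < low (right_part S)"
    "dinv ` body S = {low (left_part S)..<low (right_part S)}"
    using local_chain_dinv[OF chain[OF S] step.prems ne(1)] by (simp_all add: body_def)
  have "inj_on dinv (body S)"
    using local_chain_inj[OF chain[OF S]] body_subset[OF S] by (rule inj_on_subset)
  moreover have "dinv ` body S \<inter> dinv ` upset T = {}" unfolding IH(2) b(2) by auto
  ultimately have "inj_on dinv (body S \<union> upset T)" using IH(1) by (auto simp: inj_on_Un)
  moreover have "dinv ` (body S \<union> upset T) = {low (left_part S)..}"
    unfolding image_Un IH(2) b(2) using b(1) by auto
  ultimately show ?case by (simp add: upset_step[OF step.hyps(1)])
qed

text \<open>The two inequalities on \<open>U\<close> are those that characterise \<open>min_Delta \<gamma> \<le> n\<close> within the body of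
  \<open>U\<close>. They pass on to the successor \<open>W\<close> of \<open>U\<close> if \<open>\<gamma>\<close> lies further on: the last member of the
  body of \<open>U\<close> has smaller \<open>dinv\<close> than \<open>\<gamma>\<close>, so it satisfies the bound by \<open>n\<close>, and the left part
  of \<open>W\<close> is lower than it. The bound on \<open>dinv \<gamma>\<close> gets weaker, since \<open>opp W\<close> precedes \<open>opp U\<close>.\<close>

lemma min_Delta_along_path:
  assumes "(U, V) \<in> links\<^sup>*" "U \<in> L" "left_part U \<noteq> {}" "\<gamma> \<in> body V"
    and "height (left_part U) \<le> n" "dinv \<gamma> + k + low (right_part (opp U)) \<le> n choose 2"
  shows "min_Delta \<gamma> \<le> n"
  using assms(1-3,5,6)
proof (induction rule: converse_rtrancl_induct)
  case base
  then show ?case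
    using opposite_of_left(3)[OF opposite] assms(4) unfolding body_def by blast
next
  case (step U W)
  note ne = links_nonempty[OF step.hyps(1)]
  have W: "W \<in> L" using links_in(2)[OF step.hyps(1)] .
  note opp_link = link_opp[OF step.hyps(1)]
  have V: "V \<in> L" using path_in[OF step.hyps(2)] W by blast
  obtain \<delta> where \<delta>: "\<delta> \<in> left_part U \<union> mid_part U" "Suc (dinv \<delta>) = low (right_part U)"
    "height (right_part U) < min_Delta \<delta>"
    using local_chain_descent[OF chain[OF step.prems(1)] step.prems(2) ne(1)] .
  obtain \<mu> where \<mu>: "\<mu> \<in> Par_of_size k" "(W, tail \<mu>) \<in> links\<^sup>*" using terminus_exists[OF W] .
  have "\<gamma> \<in> upset W" using step.hyps(2) assms(4) by (auto simp: upset_def)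
  then have "dinv \<gamma> \<in> {low (left_part W)..}" using dinv_upset[OF \<mu>(2,1) ne(2)] by blast
  then have "dinv \<delta> < dinv \<gamma>" using \<delta>(2) link_eq[OF step.hyps(1)] by simp
  then have "min_Delta \<delta> \<le> n"
    using opposite_of_left(3)[OF opposite[OF step.prems(1)] step.prems(2) \<delta>(1)] step.prems(3,4) by simp
  then have "height (left_part W) \<le> n" using \<delta>(3) link_eq[OF step.hyps(1)] by simp
  moreover have "low (right_part (opp W)) \<le> low (right_part (opp U))"
  proof -
    have "left_part (opp U) \<noteq> {}" "right_part (opp U) \<noteq> {}"
      using links_nonempty(2)[OF opp_link] opposite_of_left(1)[OF opposite[OF step.prems(1)] step.prems(2)]
      by blast+
    then have "low (left_part (opp U)) < low (right_part (opp U))"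
      using local_chain_dinv[OF chain[OF opp_in[OF step.prems(1)]]] by blast
    then show ?thesis using link_eq[OF opp_link] by simp
  qed
  ultimately show ?case using step.IH[OF W ne(2)] step.prems(4) by simp
qed

section \<open>Components of the graph and their duality\<close>

definition component :: "nat list \<Rightarrow> nat list set" where
  "component \<mu> = (\<Union>V \<in> {V. (V, tail \<mu>) \<in> links\<^sup>*}. body V)"

text \<open>The component of \<open>\<mu>\<close> begins at a singleton, whose opposite is the tail of \<open>star \<mu>\<close>.\<close>

definition star :: "nat list \<Rightarrow> nat list" where
  "star \<mu> = (THE \<rho>. \<rho> \<in> Par_of_size k \<and> (opp (tail \<rho>), tail \<mu>) \<in> links\<^sup>*)"

lemma dual_path:
  assumes "\<mu> \<in> Par_of_size k" "\<rho> \<in> Par_of_size k" "(opp (tail \<rho>), tail \<mu>) \<in> links\<^sup>*"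
  shows "(opp (tail \<mu>), tail \<rho>) \<in> links\<^sup>*"
  using path_opp[OF assms(3)] by (simp add: opp_opp tail_in assms)

text \<open>By \<open>dual_path\<close> the relation between \<open>\<mu>\<close> and \<open>\<rho>\<close> is symmetric, and a given chain leads to only
  one tail; so each of \<open>\<mu>\<close> and \<open>\<rho>\<close> determines the other.\<close>

lemma star_unique:
  assumes "\<mu> \<in> Par_of_size k" "\<rho> \<in> Par_of_size k" "(opp (tail \<rho>), tail \<mu>) \<in> links\<^sup>*"
  shows "star \<mu> = \<rho>"
  unfolding star_def
proof (rule the_equality)
  fix \<sigma> assume \<sigma>: "\<sigma> \<in> Par_of_size k \<and> (opp (tail \<sigma>), tail \<mu>) \<in> links\<^sup>*"
  then have "(opp (tail \<mu>), tail \<sigma>) \<in> links\<^sup>*" using dual_path[OF assms(1)] by blast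
  with \<sigma> show "\<sigma> = \<rho>" using dual_path[OF assms] assms(2) terminus_unique by blast
qed (use assms in blast)

lemma origin_of_path:
  assumes "\<mu> \<in> Par_of_size k" "(V, tail \<mu>) \<in> links\<^sup>*"
  shows "(opp (tail (star \<mu>)), V) \<in> links\<^sup>* \<and> star \<mu> \<in> Par_of_size k"
proof -
  have "V \<in> L" using path_in[OF assms(2)] tail_in[OF assms(1)] by blast
  then obtain R where R: "R \<in> L" "left_part R = {}" "(R, V) \<in> links\<^sup>*" using origin_exists by blast
  obtain \<rho> where \<rho>: "\<rho> \<in> Par_of_size k" "R = opp (tail \<rho>)" using origin_is_opp_tail[OF R(1,2)] .
  have "(opp (tail \<rho>), tail \<mu>) \<in> links\<^sup>*" using R(3) assms(2) \<rho>(2) by simp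
  then have "star \<mu> = \<rho>" by (rule star_unique[OF assms(1) \<rho>(1)])
  with R(3) \<rho> show ?thesis by simp
qed

lemma star_path:
  assumes "\<mu> \<in> Par_of_size k"
  shows "star \<mu> \<in> Par_of_size k" "(opp (tail (star \<mu>)), tail \<mu>) \<in> links\<^sup>*"
  using origin_of_path[OF assms, of "tail \<mu>"] by simp_all

lemma star_star: "\<mu> \<in> Par_of_size k \<Longrightarrow> star (star \<mu>) = \<mu>"
  using star_unique dual_path star_path by metis

lemma component_eq_upset:
  assumes "\<mu> \<in> Par_of_size k"
  shows "component \<mu> = upset (opp (tail (star \<mu>)))"
proof -
  have "(V, tail \<mu>) \<in> links\<^sup>* \<longleftrightarrow> (opp (tail (star \<mu>)), V) \<in> links\<^sup>*" for V
    using origin_of_path[OF assms, of V] tail_terminal[OF assms, of V]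
      single_valued_confluent[OF single_valued_links star_path(2)[OF assms], of V] by auto
  then show ?thesis by (auto simp: component_def upset_def)
qed

lemma component_subset:
  assumes "\<mu> \<in> Par_of_size k"
  shows "component \<mu> \<subseteq> Par_of_defc k"
proof
  fix \<gamma> assume "\<gamma> \<in> component \<mu>"
  then obtain V where V: "(V, tail \<mu>) \<in> links\<^sup>*" "\<gamma> \<in> body V" by (auto simp: component_def)
  then have "V \<in> L" using path_in[OF V(1)] tail_in[OF assms] by blast
  then show "\<gamma> \<in> Par_of_defc k" using V(2) body_subset local_chain_subset[OF chain] by blast
qed

lemma component_disjoint:
  assumes "\<mu> \<in> Par_of_size k" "\<rho> \<in> Par_of_size k" "\<gamma> \<in> component \<mu>" "\<gamma> \<in> component \<rho>"
  shows "\<mu> = \<rho>"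
proof -
  obtain V W where V: "(V, tail \<mu>) \<in> links\<^sup>*" "\<gamma> \<in> body V"
    and W: "(W, tail \<rho>) \<in> links\<^sup>*" "\<gamma> \<in> body W"
    using assms(3,4) by (auto simp: component_def)
  have "V = W" using body_unique path_in[OF V(1)] path_in[OF W(1)] V(2) W(2) tail_in assms by blast
  then show ?thesis using terminus_unique assms(1,2) V(1) W(1) by blast
qed

text \<open>The right part of the singleton at the origin is the left part of its successor, which starts at
  \<open>dinv = \<ell>(star \<mu>)\<close>.\<close>

lemma component_dinv:
  assumes "\<mu> \<in> Par_of_size k"
  shows "inj_on dinv (component \<mu>)" "dinv ` component \<mu> = {length (star \<mu>)..}"
proof -
  let ?R = "opp (tail (star \<mu>))"
  note st = star_path[OF assms]
  note R = opp_tail[OF st(1)]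
  have RL: "?R \<in> L" using opp_in tail_in st(1) by blast
  obtain U where U: "(?R, U) \<in> links" using successor_exists[OF RL R(3)] .
  have UL: "U \<in> L" using links_in(2)[OF U] .
  obtain \<rho> where \<rho>: "\<rho> \<in> Par_of_size k" "(U, tail \<rho>) \<in> links\<^sup>*" using terminus_exists[OF UL] .
  have "body ?R = {}" using body_dinv_ge(1)[OF RL] R(1) by blast
  then have "component \<mu> = upset U" using component_eq_upset[OF assms] upset_step[OF U] by simp
  moreover have "low (left_part U) = length (star \<mu>)" using link_eq[OF U] R(2) by simp
  ultimately show "inj_on dinv (component \<mu>)" "dinv ` component \<mu> = {length (star \<mu>)..}"
    using dinv_upset[OF \<rho>(2,1) links_nonempty(2)[OF U]] by simp_all
qed

lemma component_exists:
  assumes "\<gamma> \<in> Par_of_defc k"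
  obtains \<mu> where "\<mu> \<in> Par_of_size k" "\<gamma> \<in> component \<mu>"
proof -
  obtain V where V: "V \<in> L" "\<gamma> \<in> body V" using body_exists[OF assms] .
  obtain \<mu> where "\<mu> \<in> Par_of_size k" "(V, tail \<mu>) \<in> links\<^sup>*" using terminus_exists[OF V(1)] .
  with V(2) show thesis using that by (auto simp: component_def)
qed

lemma tail_subset_component:
  assumes "\<mu> \<in> Par_of_size k"
  shows "tail \<mu> \<subseteq> component \<mu>"
proof -
  have "\<mu> \<in> Par" using assms by (simp add: Par_of_size_def)
  then have "body (tail \<mu>) = tail \<mu>" by (simp add: body_def extremes_tail(4))
  then show ?thesis unfolding component_def by blast
qed

lemma component_nu:
  assumes "\<mu> \<in> Par_of_size k" "\<gamma> \<in> component \<mu>" "nu_defined \<gamma>"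
  shows "nu \<gamma> \<in> component \<mu>"
proof -
  obtain V where V: "(V, tail \<mu>) \<in> links\<^sup>*" "\<gamma> \<in> body V" using assms(2) by (auto simp: component_def)
  have "V \<in> L" using path_in[OF V(1)] tail_in[OF assms(1)] by blast
  then obtain G where G: "body V = (\<Union>\<delta> \<in> G. nu_segment \<delta>)" using segments unfolding body_def by blast
  have "\<gamma> \<in> Par" using component_subset[OF assms(1)] assms(2) by (auto simp: Par_of_defc_def)
  with V(2) assms(3) have "nu \<gamma> \<in> body V" unfolding G using nu_segment_closed by blast
  with V(1) show ?thesis by (auto simp: component_def)
qed

text \<open>Let \<open>V\<close> be the chain with \<open>\<gamma>\<close> in its body. The bound on \<open>dinv \<gamma>\<close> in \<open>opposite_of_left\<close> says
  that the complementary value of \<open>dinv\<close> is reached at or after the right part of \<open>opp V\<close>, that is,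
  in the chains reachable from the successor \<open>U\<close> of \<open>opp V\<close>. These belong to the dual component.
  As the opposite of \<open>U\<close> precedes \<open>V\<close>, the hypotheses of \<open>min_Delta_along_path\<close> hold at \<open>U\<close>.\<close>

lemma dual_member:
  assumes "\<mu> \<in> Par_of_size k" "\<gamma> \<in> component \<mu>" "min_Delta \<gamma> \<le> n"
  obtains \<delta> where "\<delta> \<in> component (star \<mu>)" "min_Delta \<delta> \<le> n" "dinv \<gamma> + k + dinv \<delta> = n choose 2"
proof -
  obtain V where V: "(V, tail \<mu>) \<in> links\<^sup>*" "\<gamma> \<in> body V" using assms(2) by (auto simp: component_def)
  have VL: "V \<in> L" using path_in[OF V(1)] tail_in[OF assms(1)] by blast
  note lV = body_dinv_ge[OF VL V(2)]
  let ?W = "opp V"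
  have WL: "?W \<in> L" using opp_in[OF VL] .
  have rW: "right_part ?W \<noteq> {}" and h: "height (left_part V) \<le> n"
    and le: "dinv \<gamma> + k + low (right_part ?W) \<le> n choose 2"
    using opposite_of_left(1)[OF opposite[OF VL] lV(1)]
      opposite_of_left(3)[OF opposite[OF VL] lV(1) V(2)[unfolded body_def]] assms(3) by blast+
  have hW: "height (left_part V) = height (right_part ?W)"
    using opposite_of_right[OF opposite[OF WL] rW] by (simp add: opp_opp[OF VL])
  obtain U where U: "(?W, U) \<in> links" using successor_exists[OF WL rW] .
  have UL: "U \<in> L" using links_in(2)[OF U] .
  obtain \<rho> where \<rho>: "\<rho> \<in> Par_of_size k" "(U, tail \<rho>) \<in> links\<^sup>*" using terminus_exists[OF UL] .
  define i where "i = (n choose 2) - k - dinv \<gamma>"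
  have i: "dinv \<gamma> + k + i = n choose 2" "low (left_part U) \<le> i"
    using le link_eq[OF U] by (simp_all add: i_def)
  have "i \<in> dinv ` upset U" using dinv_upset[OF \<rho>(2,1) links_nonempty(2)[OF U]] i(2) by simp
  then obtain \<delta> X where \<delta>: "dinv \<delta> = i" "\<delta> \<in> body X" "(U, X) \<in> links\<^sup>*"
    unfolding upset_def by blast
  have "(opp (tail \<mu>), ?W) \<in> links\<^sup>*" by (rule path_opp[OF V(1)])
  with U \<delta>(3) have "(opp (tail \<mu>), X) \<in> links\<^sup>*" by simp
  then have "\<delta> \<in> upset (opp (tail \<mu>))" using \<delta>(2) by (auto simp: upset_def)
  then have "\<delta> \<in> component (star \<mu>)"
    using component_eq_upset[OF star_path(1)[OF assms(1)]] star_star[OF assms(1)] by simp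
  moreover have "min_Delta \<delta> \<le> n"
  proof (rule min_Delta_along_path[OF \<delta>(3) UL links_nonempty(2)[OF U] \<delta>(2)])
    show "height (left_part U) \<le> n" using h hW link_eq[OF U] by simp
    have "(opp U, V) \<in> links" using link_opp[OF U] opp_opp[OF VL] by simp
    then have "low (right_part (opp U)) \<le> dinv \<gamma>" using link_eq lV(2) by simp
    then show "dinv \<delta> + k + low (right_part (opp U)) \<le> n choose 2" using i(1) \<delta>(1) by simp
  qed
  moreover have "dinv \<gamma> + k + dinv \<delta> = n choose 2" using i(1) unfolding \<delta>(1) .
  ultimately show thesis by (rule that)
qed

text \<open>On a component the size is \<open>dinv + k\<close>. So the exponent of \<open>q\<close> at \<open>\<gamma>\<close> is \<open>dinv\<close> of its partner
  in the dual component, and vice versa.\<close>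

lemma Cat_star:
  assumes "\<mu> \<in> Par_of_size k"
  shows "Cat n (component \<mu>) q t = Cat n (component (star \<mu>)) t (q :: 'a :: comm_semiring_1)"
proof -
  define partner where "partner \<rho> \<gamma> = inv_into (component (star \<rho>)) dinv ((n choose 2) - k - dinv \<gamma>)"
    for \<rho> \<gamma>
  have partner: "partner \<rho> \<gamma> \<in> component (star \<rho>) \<inter> DP n \<and> dinv \<gamma> + k + dinv (partner \<rho> \<gamma>) = n choose 2"
    if \<rho>: "\<rho> \<in> Par_of_size k" and \<gamma>: "\<gamma> \<in> component \<rho> \<inter> DP n" for \<rho> \<gamma>
  proof -
    have "\<gamma> \<in> component \<rho>" "min_Delta \<gamma> \<le> n" using \<gamma> by (auto simp: DP_def)
    then obtain \<delta> where \<delta>: "\<delta> \<in> component (star \<rho>)" "min_Delta \<delta> \<le> n" "dinv \<gamma> + k + dinv \<delta> = n choose 2"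
      using dual_member[OF \<rho>] by blast
    have "(n choose 2) - k - dinv \<gamma> = dinv \<delta>" using \<delta>(3) by simp
    then have "partner \<rho> \<gamma> = \<delta>"
      unfolding partner_def using component_dinv(1)[OF star_path(1)[OF \<rho>]] \<delta>(1) by simp
    moreover have "\<delta> \<in> Par" using component_subset[OF star_path(1)[OF \<rho>]] \<delta>(1)
      by (auto simp: Par_of_defc_def)
    ultimately show ?thesis using \<delta> by (simp add: DP_def)
  qed
  have partner_partner: "partner (star \<rho>) (partner \<rho> \<gamma>) = \<gamma>"
    if \<rho>: "\<rho> \<in> Par_of_size k" and \<gamma>: "\<gamma> \<in> component \<rho> \<inter> DP n" for \<rho> \<gamma>
  proof -
    have "(n choose 2) - k - dinv (partner \<rho> \<gamma>) = dinv \<gamma>"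
      using partner[OF \<rho> \<gamma>] by linarith
    then show ?thesis
      unfolding partner_def[of "star \<rho>"] using component_dinv(1)[OF \<rho>] \<gamma> by (simp add: star_star[OF \<rho>])
  qed
  have size: "sum_list \<gamma> = dinv \<gamma> + k" if "\<rho> \<in> Par_of_size k" "\<gamma> \<in> component \<rho>" for \<rho> \<gamma>
    using component_subset[OF that(1)] that(2) dinv_plus_defc[of \<gamma>] by (auto simp: Par_of_defc_def)
  note s\<mu> = star_path(1)[OF assms]
  show ?thesis
    unfolding Cat_def
  proof (rule sum.reindex_bij_witness[where j = "partner \<mu>" and i = "partner (star \<mu>)"])
    fix \<gamma> assume \<gamma>: "\<gamma> \<in> component \<mu> \<inter> DP n"
    show "partner (star \<mu>) (partner \<mu> \<gamma>) = \<gamma>" by (rule partner_partner[OF assms \<gamma>])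
    note p = partner[OF assms \<gamma>]
    show "partner \<mu> \<gamma> \<in> component (star \<mu>) \<inter> DP n" using p by blast
    have "sum_list \<gamma> = dinv \<gamma> + k" "sum_list (partner \<mu> \<gamma>) = dinv (partner \<mu> \<gamma>) + k"
      using p \<gamma> size[OF assms] size[OF s\<mu>] by blast+
    with p have "(n choose 2) - sum_list \<gamma> = dinv (partner \<mu> \<gamma>)"
      "(n choose 2) - sum_list (partner \<mu> \<gamma>) = dinv \<gamma>" by linarith+
    then show "t ^ ((n choose 2) - sum_list (partner \<mu> \<gamma>)) * q ^ dinv (partner \<mu> \<gamma>)
        = q ^ ((n choose 2) - sum_list \<gamma>) * t ^ dinv \<gamma>" by (simp add: mult.commute)
  next
    fix \<delta> assume \<delta>: "\<delta> \<in> component (star \<mu>) \<inter> DP n"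
    show "partner \<mu> (partner (star \<mu>) \<delta>) = \<delta>"
      using partner_partner[OF s\<mu> \<delta>] by (simp add: star_star[OF assms])
    show "partner (star \<mu>) \<delta> \<in> component \<mu> \<inter> DP n"
      using partner[OF s\<mu> \<delta>] by (simp add: star_star[OF assms])
  qed
qed

end

theorem theorem3p10:
  assumes "\<And>k :: nat. \<exists>(L :: nat list set set) (opp :: nat list set \<Rightarrow> nat list set).
      (\<forall>S \<in> L. local_chain k S) \<and>
      (\<forall>S \<in> L. opp S \<in> L \<and> opp (opp S) = S) \<and>
      \<comment> \<open>(L-a)\<close>
      (\<forall>\<mu> \<in> Par_of_size k. tail \<mu> \<in> L) \<and>
      \<comment> \<open>(L-b)\<close>
      (\<forall>S \<in> L. \<forall>T \<in> L. S \<noteq> T \<longrightarrow>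
         S \<inter> T = {} \<or> right_part S = left_part T \<or> right_part T = left_part S) \<and>
      \<comment> \<open>(L-c)\<close>
      (\<forall>\<gamma> \<in> Par_of_defc k.
         (\<exists>S. {X \<in> L. \<gamma> \<in> X} = {S} \<and> \<gamma> \<in> mid_part S) \<or>
         (\<exists>S T. S \<noteq> T \<and> {X \<in> L. \<gamma> \<in> X} = {S, T} \<and> \<gamma> \<in> right_part S \<and> \<gamma> \<in> left_part T)) \<and>
      \<comment> \<open>(L-d)\<close>
      (\<forall>S \<in> L. locally_opposite k S (opp S)) \<and>
      \<comment> \<open>(L-e)\<close>
      (\<forall>S \<in> L. \<forall>T \<in> L. S \<inter> T \<noteq> {} \<longrightarrow> opp S \<inter> opp T \<noteq> {}) \<and>
      \<comment> \<open>(L-f)\<close>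
      (\<forall>S \<in> L. \<exists>G \<subseteq> Par. left_part S \<union> mid_part S = (\<Union>\<gamma> \<in> G. nu_segment \<gamma>))"
  shows "\<exists>(C :: nat list \<Rightarrow> nat list set) (star :: nat list \<Rightarrow> nat list).
      (\<forall>\<mu> \<in> Par. C \<mu> \<subseteq> Par) \<and>
      (\<forall>\<mu> \<in> Par. star \<mu> \<in> Par \<and> sum_list (star \<mu>) = sum_list \<mu> \<and> star (star \<mu>) = \<mu>) \<and>
      \<comment> \<open>(a)\<close>
      (\<forall>\<mu> \<in> Par. \<forall>\<rho> \<in> Par. \<mu> \<noteq> \<rho> \<longrightarrow> C \<mu> \<inter> C \<rho> = {}) \<and>
      \<comment> \<open>(b)\<close>
      (\<forall>\<mu> \<in> Par. \<forall>\<gamma> \<in> C \<mu>. defc \<gamma> = sum_list \<mu>) \<and>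
      \<comment> \<open>(c)\<close>
      (\<forall>\<mu> \<in> Par. \<exists>c :: nat \<Rightarrow> nat list.
         C \<mu> = c ` {length (star \<mu>)..} \<and> (\<forall>i \<ge> length (star \<mu>). dinv (c i) = i)) \<and>
      \<comment> \<open>(d)\<close>
      (\<forall>k. \<forall>\<gamma> \<in> Par_of_defc k. \<exists>\<mu> \<in> Par_of_size k. \<gamma> \<in> C \<mu>) \<and>
      \<comment> \<open>(e)\<close>
      (\<forall>\<mu> \<in> Par. tail \<mu> \<subseteq> C \<mu>) \<and>
      \<comment> \<open>(f)\<close>
      (\<forall>\<mu> \<in> Par. \<forall>\<gamma> \<in> C \<mu>. nu_defined \<gamma> \<longrightarrow> nu \<gamma> \<in> C \<mu>) \<and>
      \<comment> \<open>(g)\<close>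
      (\<forall>n. \<forall>\<mu> \<in> Par. Cat n (C \<mu>) var_q var_t = Cat n (C (star \<mu>)) var_t var_q)"
proof -
  have "\<exists>L opp. chain_system k L opp" for k
    using assms[of k]
  proof (elim exE conjE, goal_cases)
    case (1 L opp)
    have "chain_system k L opp"
      by (rule chain_system.intro)
        (fact 1(1)[rule_format] 1(2)[rule_format, THEN conjunct1] 1(2)[rule_format, THEN conjunct2]
          1(3-8)[rule_format])+
    then show ?case by (intro exI)
  qed
  then obtain L opp where sys: "\<And>k. chain_system k (L k) (opp k)" by metis
  define C where "C \<mu> = chain_system.component (L (sum_list \<mu>)) \<mu>" for \<mu>
  define st where "st \<mu> = chain_system.star (sum_list \<mu>) (L (sum_list \<mu>)) (opp (sum_list \<mu>)) \<mu>" for \<mu>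
  have size: "\<mu> \<in> Par_of_size (sum_list \<mu>)" if "\<mu> \<in> Par" for \<mu>
    using that by (simp add: Par_of_size_def)
  have st: "st \<mu> \<in> Par \<and> sum_list (st \<mu>) = sum_list \<mu>" if "\<mu> \<in> Par" for \<mu>
    using chain_system.star_path(1)[OF sys size[OF that]] by (simp add: Par_of_size_def st_def)
  have C_sub: "C \<mu> \<subseteq> Par_of_defc (sum_list \<mu>)" if "\<mu> \<in> Par" for \<mu>
    unfolding C_def by (rule chain_system.component_subset[OF sys size[OF that]])
  have st_st: "st (st \<mu>) = \<mu>" if "\<mu> \<in> Par" for \<mu>
    using chain_system.star_star[OF sys size[OF that]] st[OF that] by (simp add: st_def)
  have disjoint: "C \<mu> \<inter> C \<rho> = {}" if "\<mu> \<in> Par" "\<rho> \<in> Par" "\<mu> \<noteq> \<rho>" for \<mu> \<rho>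
  proof (rule ccontr)
    assume "C \<mu> \<inter> C \<rho> \<noteq> {}"
    then obtain \<gamma> where \<gamma>: "\<gamma> \<in> C \<mu>" "\<gamma> \<in> C \<rho>" by blast
    then have "defc \<gamma> = sum_list \<mu>" "defc \<gamma> = sum_list \<rho>"
      using C_sub[OF that(1)] C_sub[OF that(2)] unfolding Par_of_defc_def by blast+
    then have "sum_list \<rho> = sum_list \<mu>" by simp
    then show False
      using chain_system.component_disjoint[OF sys size[OF that(1)], of \<rho> \<gamma>] size[OF that(2)] that(3) \<gamma>
      by (simp add: C_def)
  qed
  have indexed: "\<exists>c. C \<mu> = c ` {length (st \<mu>)..} \<and> (\<forall>i \<ge> length (st \<mu>). dinv (c i) = i)"
    if "\<mu> \<in> Par" for \<mu>
  proof (intro exI conjI allI impI)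
    let ?c = "inv_into (C \<mu>) dinv"
    note dinv = chain_system.component_dinv[OF sys size[OF that], folded C_def st_def]
    show "C \<mu> = ?c ` {length (st \<mu>)..}"
      unfolding dinv(2)[symmetric] using dinv(1) by (simp add: inv_into_image_cancel)
    show "dinv (?c i) = i" if "length (st \<mu>) \<le> i" for i
      using that dinv(2) by (intro f_inv_into_f) simp
  qed
  have cover: "\<exists>\<mu> \<in> Par_of_size k. \<gamma> \<in> C \<mu>" if \<gamma>: "\<gamma> \<in> Par_of_defc k" for k \<gamma>
  proof -
    obtain \<mu> where "\<mu> \<in> Par_of_size k" "\<gamma> \<in> chain_system.component (L k) \<mu>" using chain_system.component_exists[OF sys \<gamma>] .
    then show ?thesis by (auto simp: C_def Par_of_size_def)
  qed
  have tails: "tail \<mu> \<subseteq> C \<mu>" if "\<mu> \<in> Par" for \<mu>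
    unfolding C_def by (rule chain_system.tail_subset_component[OF sys size[OF that]])
  have nu_closed: "nu \<gamma> \<in> C \<mu>" if "\<mu> \<in> Par" "\<gamma> \<in> C \<mu>" "nu_defined \<gamma>" for \<mu> \<gamma>
    using chain_system.component_nu[OF sys size[OF that(1)]] that(2,3) by (simp add: C_def)
  have dual: "Cat n (C \<mu>) var_q var_t = Cat n (C (st \<mu>)) var_t var_q" if "\<mu> \<in> Par" for n \<mu>
    using chain_system.Cat_star[OF sys size[OF that], of n var_q var_t] st[OF that] by (simp add: C_def st_def)
  show ?thesis
  proof (intro exI[of _ C] exI[of _ st] conjI ballI allI impI)
    fix \<mu> assume \<mu>: "\<mu> \<in> Par"
    show "C \<mu> \<subseteq> Par" using C_sub[OF \<mu>] unfolding Par_of_defc_def by blast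
    show "defc \<gamma> = sum_list \<mu>" if "\<gamma> \<in> C \<mu>" for \<gamma>
      using C_sub[OF \<mu>] that unfolding Par_of_defc_def by blast
    show "st \<mu> \<in> Par" "sum_list (st \<mu>) = sum_list \<mu>" using st[OF \<mu>] by simp_all
    show "st (st \<mu>) = \<mu>" by (rule st_st[OF \<mu>])
    show "\<exists>c. C \<mu> = c ` {length (st \<mu>)..} \<and> (\<forall>i \<ge> length (st \<mu>). dinv (c i) = i)"
      by (rule indexed[OF \<mu>])
    show "tail \<mu> \<subseteq> C \<mu>" by (rule tails[OF \<mu>])
    show "C \<mu> \<inter> C \<rho> = {}" if "\<rho> \<in> Par" "\<mu> \<noteq> \<rho>" for \<rho> by (rule disjoint[OF \<mu> that])
    show "nu \<gamma> \<in> C \<mu>" if "\<gamma> \<in> C \<mu>" "nu_defined \<gamma>" for \<gamma> by (rule nu_closed[OF \<mu> that])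
    show "Cat n (C \<mu>) var_q var_t = Cat n (C (st \<mu>)) var_t var_q" for n by (rule dual[OF \<mu>])
  next
    show "\<exists>\<mu> \<in> Par_of_size k. \<gamma> \<in> C \<mu>" if "\<gamma> \<in> Par_of_defc k" for k \<gamma> by (rule cover[OF that])
  qed
qed

end
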